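(* Let $\mathcal{H}$ be a finite-dimensional Hilbert space and $\Phi\colon\mathbf{B}(\mathcal{H})\to\mathbf{B}(\mathcal{H})$ an idempotent unital completely positive (UCP) map, i.e. $\Phi^2=\Phi$. Then there exist a subspace $\mathcal{M}\subseteq\mathcal{H}$ with inclusion map $J_{\mathcal{M}}\colon\mathcal{M}\to\mathcal{H}$, a $C^*$ algebra $\mathcal{A}$, and UCP maps $\Delta\colon\mathcal{A}\to\mathbf{B}(\mathcal{H})$ and $\Gamma\colon\mathbf{B}(\mathcal{M})\to\mathcal{A}$ such that, with $C_{\mathcal{M}}\colon\mathbf{B}(\mathcal{H})\to\mathbf{B}(\mathcal{M})$ defined by $C_{\mathcal{M}}(X)=J_{\mathcal{M}}^\dagger XJ_{\mathcal{M}}$, $$\Gamma C_{\mathcal{M}}\Delta=1_{\mathcal{A}},\qquad \Delta\Gamma C_{\mathcal{M}}=\Phi .$$ Furthermore, $w=C_{\mathcal{M}}\Delta\colon\mathcal{A}\to\mathbf{B}(\mathcal{M})$ is a homomorphism of $C^*$ algebras, and all operators in the image of $\Delta$ are block-diagonal with respect to the decomposition $\mathcal{H}=\mathcal{M}\oplus\mathcal{M}^\perp$.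
   Context: $\mathbf{B}(\mathcal{L})$ denotes the algebra of bounded operators on a nonzero Hilbert space $\mathcal{L}$. All algebras are unital with nonzero unit, and homomorphisms of $C^*$ algebras are unital $*$-homomorphisms. $1_{\mathcal{A}}$ denotes the identity map on $\mathcal{A}$; the dagger denotes the Hermitian adjoint; juxtaposition of maps denotes composition. *)

theory Defs
  imports "HOL-Analysis.Analysis" "HOL-Algebra.Ring"
begin

section \<open>Complex inner product spaces\<close>

text \<open>
  The underlying real inner product is the real part of the complex one, so norm, topology and
  completeness come from the library. The sort \<open>{complex_inner, euclidean_space}\<close> then describes
  the nonzero finite-dimensional complex Hilbert spaces: the constant \<open>Basis\<close> of
  \<open>euclidean_space\<close> is an orthonormal basis of the underlying real space, which always exists.
\<close>

class complex_inner = real_inner +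
  fixes scaleC :: "complex \<Rightarrow> 'a \<Rightarrow> 'a"  (infixr \<open>*\<^sub>C\<close> 75)
    and cinner :: "'a \<Rightarrow> 'a \<Rightarrow> complex"
  assumes scaleC_of_real: "complex_of_real r *\<^sub>C x = r *\<^sub>R x"
    and scaleC_add_right: "a *\<^sub>C (x + y) = a *\<^sub>C x + a *\<^sub>C y"
    and scaleC_add_left: "(a + b) *\<^sub>C x = a *\<^sub>C x + b *\<^sub>C x"
    and scaleC_scaleC: "a *\<^sub>C b *\<^sub>C x = (a * b) *\<^sub>C x"
    and cinner_commute: "cinner x y = cnj (cinner y x)"
    and cinner_add_right: "cinner x (y + z) = cinner x y + cinner x z"
    and cinner_scaleC_right: "cinner x (a *\<^sub>C y) = a * cinner x y"
    and Re_cinner: "Re (cinner x y) = x \<bullet> y"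

global_interpretation complex_vector:
  vector_space "scaleC :: complex \<Rightarrow> 'a \<Rightarrow> 'a::complex_inner"
proof
  show "1 *\<^sub>C x = x" for x :: 'a
    using scaleC_of_real[of 1 x] by simp
qed (simp_all add: scaleC_add_right scaleC_add_left scaleC_scaleC)

instantiation complex :: complex_inner
begin

definition scaleC_complex :: "complex \<Rightarrow> complex \<Rightarrow> complex"
  where "scaleC_complex a x = a * x"

definition cinner_complex :: "complex \<Rightarrow> complex \<Rightarrow> complex"
  where "cinner_complex x y = cnj x * y"

instance
  by standard (auto simp: scaleC_complex_def cinner_complex_def inner_complex_def
      algebra_simps scaleR_conv_of_real)

end

instantiation vec :: (complex_inner, finite) complex_inner
begin

definition scaleC_vec :: "complex \<Rightarrow> 'a ^ 'b \<Rightarrow> 'a ^ 'b"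
  where "scaleC_vec a x = (\<chi> i. a *\<^sub>C x $ i)"

definition cinner_vec :: "'a ^ 'b \<Rightarrow> 'a ^ 'b \<Rightarrow> complex"
  where "cinner_vec x y = (\<Sum>i\<in>UNIV. cinner (x $ i) (y $ i))"

instance
proof
  show "cinner x y = cnj (cinner y x)" for x y :: "'a ^ 'b"
    unfolding cinner_vec_def cnj_sum by (intro sum.cong refl cinner_commute)
qed (auto simp: scaleC_vec_def cinner_vec_def inner_vec_def vec_eq_iff scaleC_of_real
      scaleC_add_right scaleC_add_left scaleC_scaleC cinner_add_right cinner_scaleC_right
      Re_cinner sum.distrib sum_distrib_left)

end


section \<open>Star algebras and C*-algebras\<close>

record 'a star_algebra = "'a ring" +
  cscale :: "complex \<Rightarrow> 'a \<Rightarrow> 'a"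
  star :: "'a \<Rightarrow> 'a"

record 'a cstar = "'a star_algebra" +
  cnorm :: "'a \<Rightarrow> real"

text \<open>Not necessarily commutative, unital, with nonzero unit.\<close>

locale cstar_algebra = ring A for A :: "('a, 'm) cstar_scheme" (structure) +
  assumes one_not_zero: "\<one> \<noteq> \<zero>"
    and cscale_closed: "x \<in> carrier A \<Longrightarrow> cscale A c x \<in> carrier A"
    and cscale_add_right: "\<lbrakk>x \<in> carrier A; y \<in> carrier A\<rbrakk>
      \<Longrightarrow> cscale A c (x \<oplus> y) = cscale A c x \<oplus> cscale A c y"
    and cscale_add_left: "x \<in> carrier A \<Longrightarrow> cscale A (c + d) x = cscale A c x \<oplus> cscale A d x"
    and cscale_cscale: "x \<in> carrier A \<Longrightarrow> cscale A c (cscale A d x) = cscale A (c * d) x"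
    and cscale_one: "x \<in> carrier A \<Longrightarrow> cscale A 1 x = x"
    and cscale_mult_left: "\<lbrakk>x \<in> carrier A; y \<in> carrier A\<rbrakk>
      \<Longrightarrow> cscale A c x \<otimes> y = cscale A c (x \<otimes> y)"
    and cscale_mult_right: "\<lbrakk>x \<in> carrier A; y \<in> carrier A\<rbrakk>
      \<Longrightarrow> x \<otimes> cscale A c y = cscale A c (x \<otimes> y)"
    and star_closed: "x \<in> carrier A \<Longrightarrow> star A x \<in> carrier A"
    and star_star: "x \<in> carrier A \<Longrightarrow> star A (star A x) = x"
    and star_add: "\<lbrakk>x \<in> carrier A; y \<in> carrier A\<rbrakk> \<Longrightarrow> star A (x \<oplus> y) = star A x \<oplus> star A y"
    and star_mult: "\<lbrakk>x \<in> carrier A; y \<in> carrier A\<rbrakk> \<Longrightarrow> star A (x \<otimes> y) = star A y \<otimes> star A x"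
    and star_cscale: "x \<in> carrier A \<Longrightarrow> star A (cscale A c x) = cscale A (cnj c) (star A x)"
    and cnorm_nonneg: "x \<in> carrier A \<Longrightarrow> 0 \<le> cnorm A x"
    and cnorm_eq_0_iff: "x \<in> carrier A \<Longrightarrow> cnorm A x = 0 \<longleftrightarrow> x = \<zero>"
    and cnorm_triangle: "\<lbrakk>x \<in> carrier A; y \<in> carrier A\<rbrakk>
      \<Longrightarrow> cnorm A (x \<oplus> y) \<le> cnorm A x + cnorm A y"
    and cnorm_cscale: "x \<in> carrier A \<Longrightarrow> cnorm A (cscale A c x) = cmod c * cnorm A x"
    and cnorm_mult: "\<lbrakk>x \<in> carrier A; y \<in> carrier A\<rbrakk> \<Longrightarrow> cnorm A (x \<otimes> y) \<le> cnorm A x * cnorm A y"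
    and cstar_identity: "x \<in> carrier A \<Longrightarrow> cnorm A (star A x \<otimes> x) = (cnorm A x)\<^sup>2"
    and complete: "Metric_space.mcomplete (carrier A) (\<lambda>x y. cnorm A (x \<ominus> y))"

definition linear_map ::
    "('a, 'm) star_algebra_scheme \<Rightarrow> ('b, 'n) star_algebra_scheme \<Rightarrow> ('a \<Rightarrow> 'b) \<Rightarrow> bool"
  where "linear_map A B f \<longleftrightarrow> f \<in> carrier A \<rightarrow> carrier B \<and>
    (\<forall>x\<in>carrier A. \<forall>y\<in>carrier A. f (x \<oplus>\<^bsub>A\<^esub> y) = f x \<oplus>\<^bsub>B\<^esub> f y) \<and>
    (\<forall>c. \<forall>x\<in>carrier A. f (cscale A c x) = cscale B c (f x))"

definition cstar_hom ::
    "('a, 'm) star_algebra_scheme \<Rightarrow> ('b, 'n) star_algebra_scheme \<Rightarrow> ('a \<Rightarrow> 'b) \<Rightarrow> bool"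
  where "cstar_hom A B f \<longleftrightarrow> f \<in> ring_hom A B \<and> linear_map A B f \<and>
    (\<forall>x\<in>carrier A. f (star A x) = star B (f x))"

definition mat_algebra :: "nat \<Rightarrow> ('a, 'm) star_algebra_scheme \<Rightarrow> (nat \<times> nat \<Rightarrow> 'a) star_algebra"
  where "mat_algebra n A = \<lparr>
    carrier = {..<n} \<times> {..<n} \<rightarrow>\<^sub>E carrier A,
    mult = (\<lambda>X Y. \<lambda>(i, j)\<in>{..<n} \<times> {..<n}. \<Oplus>\<^bsub>A\<^esub>k\<in>{..<n}. X (i, k) \<otimes>\<^bsub>A\<^esub> Y (k, j)),
    one = (\<lambda>(i, j)\<in>{..<n} \<times> {..<n}. if i = j then \<one>\<^bsub>A\<^esub> else \<zero>\<^bsub>A\<^esub>),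
    zero = (\<lambda>(i, j)\<in>{..<n} \<times> {..<n}. \<zero>\<^bsub>A\<^esub>),
    add = (\<lambda>X Y. \<lambda>(i, j)\<in>{..<n} \<times> {..<n}. X (i, j) \<oplus>\<^bsub>A\<^esub> Y (i, j)),
    cscale = (\<lambda>c X. \<lambda>(i, j)\<in>{..<n} \<times> {..<n}. cscale A c (X (i, j))),
    star = (\<lambda>X. \<lambda>(i, j)\<in>{..<n} \<times> {..<n}. star A (X (j, i)))\<rparr>"

definition positives :: "('a, 'm) star_algebra_scheme \<Rightarrow> 'a set"
  where "positives A = {star A y \<otimes>\<^bsub>A\<^esub> y | y. y \<in> carrier A}"

definition completely_positive ::
    "('a, 'm) star_algebra_scheme \<Rightarrow> ('b, 'n) star_algebra_scheme \<Rightarrow> ('a \<Rightarrow> 'b) \<Rightarrow> bool"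
  where "completely_positive A B f \<longleftrightarrow> linear_map A B f \<and>
    (\<forall>n. \<forall>X\<in>positives (mat_algebra n A).
      (\<lambda>ij\<in>{..<n} \<times> {..<n}. f (X ij)) \<in> positives (mat_algebra n B))"

definition ucp ::
    "('a, 'm) star_algebra_scheme \<Rightarrow> ('b, 'n) star_algebra_scheme \<Rightarrow> ('a \<Rightarrow> 'b) \<Rightarrow> bool"
  where "ucp A B f \<longleftrightarrow> completely_positive A B f \<and> f \<one>\<^bsub>A\<^esub> = \<one>\<^bsub>B\<^esub>"


section \<open>Bounded operators between subspaces\<close>

text \<open>
  A Hilbert space is represented by a (closed) complex subspace of an ambient type; operators
  defined on it are functions that are \<open>undefined\<close> outside of it. The whole type is \<open>UNIV\<close>.
\<close>

definition bounded_ops :: "'h::complex_inner set \<Rightarrow> 'h set \<Rightarrow> ('h \<Rightarrow> 'h) set"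
  where "bounded_ops K L = {T \<in> K \<rightarrow>\<^sub>E L.
    (\<forall>x\<in>K. \<forall>y\<in>K. T (x + y) = T x + T y) \<and>
    (\<forall>c. \<forall>x\<in>K. T (c *\<^sub>C x) = c *\<^sub>C T x) \<and>
    (\<exists>b. \<forall>x\<in>K. norm (T x) \<le> b * norm x)}"

definition hadjoint :: "'h::complex_inner set \<Rightarrow> 'h set \<Rightarrow> ('h \<Rightarrow> 'h) \<Rightarrow> ('h \<Rightarrow> 'h)"
  where "hadjoint K L T =
    (THE S. S \<in> bounded_ops L K \<and> (\<forall>x\<in>K. \<forall>y\<in>L. cinner (T x) y = cinner x (S y)))"

definition bop :: "'h::complex_inner set \<Rightarrow> ('h \<Rightarrow> 'h) cstar"
  where "bop L = \<lparr>
    carrier = bounded_ops L L,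
    mult = compose L,
    one = (\<lambda>x\<in>L. x),
    zero = (\<lambda>x\<in>L. 0),
    add = (\<lambda>S T. \<lambda>x\<in>L. S x + T x),
    cscale = (\<lambda>c T. \<lambda>x\<in>L. c *\<^sub>C T x),
    star = hadjoint L L,
    cnorm = (\<lambda>T. SUP x\<in>L. norm (T x) / norm x)\<rparr>"

definition inclusion :: "'h::complex_inner set \<Rightarrow> 'h \<Rightarrow> 'h"
  where "inclusion M = (\<lambda>x\<in>M. x)"

definition compression :: "'h::complex_inner set \<Rightarrow> ('h \<Rightarrow> 'h) \<Rightarrow> ('h \<Rightarrow> 'h)"
  where "compression M X = compose M (hadjoint M UNIV (inclusion M)) (compose M X (inclusion M))"

definition ortho_compl :: "'h::complex_inner set \<Rightarrow> 'h set"
  where "ortho_compl M = {x. \<forall>y\<in>M. cinner y x = 0}"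

definition block_diagonal :: "'h::complex_inner set \<Rightarrow> ('h \<Rightarrow> 'h) \<Rightarrow> bool"
  where "block_diagonal M X \<longleftrightarrow> X ` M \<subseteq> M \<and> X ` ortho_compl M \<subseteq> ortho_compl M"

end

theory Submission
  imports Defs "HOL-Library.Function_Algebras" "HOL-Computational_Algebra.Fundamental_Theorem_Algebra"
begin

text \<open>
  A unital completely positive map on the operators of a finite-dimensional space has a Kraus
  representation \<open>\<Phi> X = (\<Sum>k. V\<^sub>k* X V\<^sub>k)\<close> with \<open>(\<Sum>k. V\<^sub>k* V\<^sub>k) = 1\<close>: the matrix of the operators
  \<open>\<Phi> E\<^sub>i\<^sub>j\<close>, where \<open>E\<^sub>i\<^sub>j\<close> are the matrix units, is of the form \<open>Z* Z\<close>, and the entries of \<open>Z\<close>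
  yield the \<open>V\<^sub>k\<close> (\<open>kraus_representation\<close>). The subspace \<open>M\<close> is the span of the ranges of
  the \<open>V\<^sub>k\<close>. Since \<open>X\<close> enters the Kraus formula only between vectors of \<open>M\<close>, \<open>\<Phi> X\<close> depends only
  on the compression of \<open>X\<close> to \<open>M\<close>.

  Idempotence enters through one computation. If \<open>\<Phi> X = X\<close>, then
  \<open>(\<Sum>k. \<parallel>X V\<^sub>k v - V\<^sub>k X v\<parallel>\<^sup>2) = \<langle>v, (\<Phi> (X* X) - X* X) v\<rangle>\<close>.
  Putting \<open>v = V\<^sub>m x\<close> and summing over \<open>m\<close> turns the right-hand side into
  \<open>\<langle>x, (\<Phi> (\<Phi> (X* X)) - \<Phi> (X* X)) x\<rangle> = 0\<close>. Hence every fixed operator of \<open>\<Phi>\<close> commutes with all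
  \<open>V\<^sub>k\<close> on \<open>M\<close> (\<open>fixed_commutes\<close>). Moreover \<open>M\<close> is already spanned by the vectors \<open>V\<^sub>k V\<^sub>m x\<close>,
  because \<open>\<Phi>\<close> and its square have the same Kraus support (\<open>support_iterated\<close>). Together, fixed operators map
  \<open>M\<close> into itself; applied to \<open>X\<close> and to \<open>X*\<close>, this is block-diagonality.

  Let \<open>A\<close> be the algebra of those operators on \<open>M\<close> that commute with all \<open>V\<^sub>k\<close> and with the adjoints of
  their restrictions to \<open>M\<close>. As a commutant of a self-adjoint family it is a C*-subalgebra of \<open>B(M)\<close>.
  Compressions of fixed operators lie in \<open>A\<close>. Conversely, for \<open>a \<in> A\<close> the operator
  \<open>\<Delta> a = \<Phi> (J a J*)\<close>, with \<open>J\<close> the inclusion of \<open>M\<close>, compresses to \<open>(\<Sum>k. V\<^sub>k* V\<^sub>k) a = a\<close>. So \<open>w\<close> is simply the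
  inclusion of \<open>A\<close> into \<open>B(M)\<close>, \<open>\<Gamma> Y\<close> is the compression of \<open>\<Phi> (J Y J*)\<close>, and the two equations
  are immediate.

  Complete positivity of \<open>\<Gamma>\<close> needs one more idea: a positive matrix with entries in \<open>A\<close> must be
  factored as \<open>Z* Z\<close> with the entries of \<open>Z\<close> again in \<open>A\<close>. A positive operator \<open>T\<close> on a
  finite-dimensional space has a square root that is a polynomial in \<open>T\<close>
  (\<open>square_root\<close>), and a polynomial in \<open>T\<close> commutes with everything that commutes with \<open>T\<close>.
  Thus positivity in matrices over any commutant amounts to nonnegativity of a quadratic form
  (\<open>positives_if_mat_form\<close>), and every map given by a Kraus formula preserves such forms.
\<close>

section \<open>Complex inner products over a Euclidean space\<close>

lemma cinner_add_left: "cinner (x + y) z = cinner x z + cinner y z"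
  by (metis cinner_add_right cinner_commute complex_cnj_add)

lemma cinner_scaleC_left: "cinner (a *\<^sub>C x) y = cnj a * cinner x y"
  by (metis cinner_commute cinner_scaleC_right complex_cnj_mult)

lemma cinner_zero_right [simp]: "cinner x 0 = 0"
  using cinner_scaleC_right[of x 0 0] by simp

lemma cinner_zero_left [simp]: "cinner 0 x = 0"
  using cinner_scaleC_left[of 0 0 x] by simp

lemma cinner_minus_right [simp]: "cinner x (- y) = - cinner x y"
  using cinner_scaleC_right[of x "-1" y] by simp

lemma cinner_minus_left [simp]: "cinner (- x) y = - cinner x y"
  using cinner_scaleC_left[of "-1" x y] by simp

lemma cinner_diff_right: "cinner x (y - z) = cinner x y - cinner x z"
  using cinner_add_right[of x y "- z"] by simp

lemma cinner_diff_left: "cinner (x - y) z = cinner x z - cinner y z"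
  using cinner_add_left[of x "- y" z] by simp

lemma cinner_sum_right: "cinner x (\<Sum>i\<in>I. f i) = (\<Sum>i\<in>I. cinner x (f i))"
  by (induction I rule: infinite_finite_induct) (auto simp: cinner_add_right)

lemma cinner_sum_left: "cinner (\<Sum>i\<in>I. f i) x = (\<Sum>i\<in>I. cinner (f i) x)"
  by (induction I rule: infinite_finite_induct) (auto simp: cinner_add_left)

lemma cinner_self: "cinner x x = complex_of_real ((norm x)\<^sup>2)"
proof (rule complex_eqI)
  show "Re (cinner x x) = Re (complex_of_real ((norm x)\<^sup>2))"
    by (simp add: Re_cinner power2_norm_eq_inner)
  show "Im (cinner x x) = Im (complex_of_real ((norm x)\<^sup>2))"
    using arg_cong[OF cinner_commute[of x x], of Im] by simp
qed

lemma cinner_self_eq_0_iff [simp]: "cinner x x = 0 \<longleftrightarrow> x = 0"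
  by (simp add: cinner_self)

lemma norm_scaleC: "norm (c *\<^sub>C x) = cmod c * norm x"
proof -
  have "cinner (c *\<^sub>C x) (c *\<^sub>C x) = (cnj c * c) * cinner x x"
    by (simp add: cinner_scaleC_left cinner_scaleC_right)
  also have "\<dots> = complex_of_real ((cmod c * norm x)\<^sup>2)"
    by (simp add: cinner_self power_mult_distrib mult.commute[of "cnj c"] flip: complex_norm_square)
  finally have "(norm (c *\<^sub>C x))\<^sup>2 = (cmod c * norm x)\<^sup>2"
    unfolding cinner_self of_real_eq_iff .
  then show ?thesis
    by (simp add: power2_eq_iff_nonneg)
qed

lemma Im_cinner: "Im (cinner x y) = (\<i> *\<^sub>C x) \<bullet> y"
  unfolding Re_cinner[symmetric] cinner_scaleC_left by simp

lemma scaleR_eq_scaleC: "r *\<^sub>R x = complex_of_real r *\<^sub>C x"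
  by (simp add: scaleC_of_real)

lemma subspace_if_complex_subspace: "complex_vector.subspace M \<Longrightarrow> subspace M"
  by (auto simp: complex_vector.subspace_def subspace_def scaleR_eq_scaleC)

lemma cinner_eq_0_if_real_orthogonal:
  assumes "complex_vector.subspace M" "\<And>y. y \<in> M \<Longrightarrow> y \<bullet> x = 0" "y \<in> M"
  shows "cinner y x = 0"
proof (rule complex_eqI)
  show "Re (cinner y x) = Re 0"
    using assms by (simp add: Re_cinner)
  show "Im (cinner y x) = Im 0"
    using assms complex_vector.subspace_scale[OF assms(1), of y \<i>] by (simp add: Im_cinner)
qed

text \<open>
  An orthonormal basis of the underlying real space is not linearly independent over the complex
  numbers, but it is a tight frame with bound 2: it is orthonormal for the real part of the inner product, and so is
  its image under multiplication by \<open>\<i>\<close>. This is enough for all coordinate computations.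
\<close>
lemma frame_expansion:
  fixes x :: "'h::{complex_inner, euclidean_space}"
  shows "(\<Sum>b\<in>Basis. cinner b x *\<^sub>C b) = 2 *\<^sub>C x"
proof -
  have "cinner b x *\<^sub>C b = (x \<bullet> b) *\<^sub>R b - \<i> *\<^sub>C (((\<i> *\<^sub>C x) \<bullet> b) *\<^sub>R b)" for b :: 'h
  proof -
    have "Im (cinner b x) = - ((\<i> *\<^sub>C x) \<bullet> b)"
      using arg_cong[OF cinner_commute[of b x], of Im] by (simp add: Im_cinner)
    then have "cinner b x = complex_of_real (x \<bullet> b) - \<i> * complex_of_real ((\<i> *\<^sub>C x) \<bullet> b)"
      by (simp add: complex_eq_iff Re_cinner inner_commute)
    then show ?thesis
      by (simp add: scaleR_eq_scaleC complex_vector.scale_left_diff_distrib)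
  qed
  then have "(\<Sum>b\<in>Basis. cinner b x *\<^sub>C b)
      = (\<Sum>b\<in>Basis. (x \<bullet> b) *\<^sub>R b) - \<i> *\<^sub>C (\<Sum>b\<in>Basis. ((\<i> *\<^sub>C x) \<bullet> b) *\<^sub>R b)"
    by (simp add: sum_subtractf complex_vector.scale_sum_right)
  also have "\<dots> = x - \<i> *\<^sub>C \<i> *\<^sub>C x"
    by (simp only: euclidean_representation)
  also have "\<dots> = 2 *\<^sub>C x"
    by (simp flip: complex_vector.scale_left_distrib[of 1 1, simplified])
  finally show ?thesis .
qed

lemma frame_Parseval:
  fixes x :: "'h::{complex_inner, euclidean_space}"
  shows "(\<Sum>b\<in>Basis. cinner x b * cinner b y) = 2 * cinner x y"
proof -
  have "(\<Sum>b\<in>Basis. cinner x b * cinner b y) = cinner x (\<Sum>b\<in>Basis. cinner b y *\<^sub>C b)"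
    by (simp add: cinner_sum_right cinner_scaleC_right mult.commute)
  then show ?thesis
    by (simp add: frame_expansion cinner_scaleC_right)
qed

section \<open>Orthogonal projections and adjoints\<close>

definition proj :: "'h::complex_inner set \<Rightarrow> 'h \<Rightarrow> 'h"
  where "proj M x = (SOME p. p \<in> M \<and> (\<forall>y\<in>M. cinner y (x - p) = 0))"

context
  fixes M :: "'h::{complex_inner, euclidean_space} set"
  assumes M: "complex_vector.subspace M"
begin

lemma proj_works: "proj M x \<in> M \<and> (\<forall>y\<in>M. cinner y (x - proj M x) = 0)"
  unfolding proj_def
proof (rule someI_ex)
  obtain p z where "p \<in> span M" and z: "\<And>w. w \<in> span M \<Longrightarrow> orthogonal z w" and "x = p + z"
    using orthogonal_subspace_decomp_exists[of M x] by metis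
  then have "p \<in> M" "x - p = z"
    using span_eq_iff[THEN iffD2, OF subspace_if_complex_subspace[OF M]] by auto
  moreover have "\<forall>y\<in>M. cinner y z = 0"
    using z by (auto intro!: cinner_eq_0_if_real_orthogonal[OF M] simp: orthogonal_def inner_commute span_base)
  ultimately show "\<exists>p. p \<in> M \<and> (\<forall>y\<in>M. cinner y (x - p) = 0)"
    by blast
qed

lemma proj_in: "proj M x \<in> M"
  using proj_works by blast

lemma cinner_proj_right: "y \<in> M \<Longrightarrow> cinner y (proj M x) = cinner y x"
  using proj_works[of x] by (simp add: cinner_diff_right)

lemma cinner_proj_left: "y \<in> M \<Longrightarrow> cinner (proj M x) y = cinner x y"
  by (metis cinner_commute cinner_proj_right)

lemma eq_if_cinner_eq:
  assumes "x \<in> M" "y \<in> M" "\<And>z. z \<in> M \<Longrightarrow> cinner z x = cinner z y"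
  shows "x = y"
proof -
  have "x - y \<in> M"
    using assms complex_vector.subspace_diff[OF M] by blast
  then have "cinner (x - y) (x - y) = 0"
    using assms(3) by (simp add: cinner_diff_right)
  then show ?thesis
    by simp
qed

lemma proj_eqI:
  assumes "p \<in> M" "\<And>y. y \<in> M \<Longrightarrow> cinner y p = cinner y x"
  shows "proj M x = p"
  using assms by (intro eq_if_cinner_eq) (auto simp: proj_in cinner_proj_right)

lemma proj_ident: "x \<in> M \<Longrightarrow> proj M x = x"
  by (rule proj_eqI) auto

lemma proj_add: "proj M (x + y) = proj M x + proj M y"
  by (rule proj_eqI)
    (auto simp: proj_in complex_vector.subspace_add[OF M] cinner_add_right cinner_proj_right)

lemma proj_scaleC: "proj M (c *\<^sub>C x) = c *\<^sub>C proj M x"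
  by (rule proj_eqI)
    (auto simp: proj_in complex_vector.subspace_scale[OF M] cinner_scaleC_right cinner_proj_right)

end

text \<open>
  Boundedness is automatic in finite dimension, and values outside of \<open>K\<close> are left open, so that
  one function can be regarded as an operator on several subspaces.
\<close>
definition operator_on :: "'h::complex_inner set \<Rightarrow> 'h set \<Rightarrow> ('h \<Rightarrow> 'h) \<Rightarrow> bool"
  where "operator_on K L T \<longleftrightarrow> T ` K \<subseteq> L \<and>
    (\<forall>x\<in>K. \<forall>y\<in>K. T (x + y) = T x + T y) \<and> (\<forall>c. \<forall>x\<in>K. T (c *\<^sub>C x) = c *\<^sub>C T x)"

lemma
  assumes "operator_on K L T"
  shows operator_on_in: "x \<in> K \<Longrightarrow> T x \<in> L"
    and operator_on_add: "\<lbrakk>x \<in> K; y \<in> K\<rbrakk> \<Longrightarrow> T (x + y) = T x + T y"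
    and operator_on_scaleC: "x \<in> K \<Longrightarrow> T (c *\<^sub>C x) = c *\<^sub>C T x"
  using assms unfolding operator_on_def by auto

lemma operator_on_sum:
  assumes "operator_on K L T" "complex_vector.subspace K" "\<And>i. i \<in> I \<Longrightarrow> f i \<in> K"
  shows "T (\<Sum>i\<in>I. f i) = (\<Sum>i\<in>I. T (f i))"
proof -
  have T0: "T 0 = 0"
    using operator_on_scaleC[OF assms(1), of 0 0] complex_vector.subspace_0[OF assms(2)] by simp
  show ?thesis
    using assms(3)
    by (induction I rule: infinite_finite_induct)
      (simp_all add: T0 operator_on_add[OF assms(1)] complex_vector.subspace_sum[OF assms(2)])
qed

lemma linear_operator_on_comp_proj:
  fixes T :: "'h::{complex_inner, euclidean_space} \<Rightarrow> 'h"
  assumes "complex_vector.subspace K" "operator_on K L T"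
  shows "linear (\<lambda>x. T (proj K x))"
  using assms
  by (intro linearI)
    (simp_all add: proj_add proj_scaleC proj_in operator_on_add operator_on_scaleC scaleR_eq_scaleC)

lemma operator_on_bounded:
  fixes T :: "'h::{complex_inner, euclidean_space} \<Rightarrow> 'h"
  assumes "complex_vector.subspace K" "operator_on K L T"
  shows "\<exists>b. \<forall>x\<in>K. norm (T x) \<le> b * norm x"
proof -
  obtain b where "\<And>x. norm (T (proj K x)) \<le> b * norm x"
    using linear_bounded[OF linear_operator_on_comp_proj[OF assms]] by blast
  then show ?thesis
    by (metis assms(1) proj_ident)
qed

lemma bounded_ops_iff:
  fixes T :: "'h::{complex_inner, euclidean_space} \<Rightarrow> 'h"
  assumes "complex_vector.subspace K"
  shows "T \<in> bounded_ops K L \<longleftrightarrow> T \<in> extensional K \<and> operator_on K L T"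
  using operator_on_bounded[OF assms, of L T]
  by (auto simp: bounded_ops_def operator_on_def PiE_def)

lemma operator_on_restrict:
  assumes "complex_vector.subspace K" "operator_on K L T"
  shows "operator_on K L (restrict T K)"
  using assms
  by (auto simp: operator_on_def complex_vector.subspace_add complex_vector.subspace_scale)

lemma operator_on_comp_proj:
  fixes T :: "'h::{complex_inner, euclidean_space} \<Rightarrow> 'h"
  assumes "complex_vector.subspace K" "operator_on K L T"
  shows "operator_on UNIV L (\<lambda>x. T (proj K x))"
  using assms unfolding operator_on_def
  by (auto simp: proj_add proj_scaleC proj_in)

context
  fixes K L :: "'h::{complex_inner, euclidean_space} set" and T :: "'h \<Rightarrow> 'h"
  assumes K: "complex_vector.subspace K" and L: "complex_vector.subspace L"
    and T: "operator_on K L T"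
begin

text \<open>
  The adjoint of the underlying real-linear map is also the complex adjoint, because the imaginary part of
  the inner product of \<open>x\<close> and \<open>y\<close> is the real inner product of \<open>\<i> x\<close> and \<open>y\<close>.
\<close>
lemma adjoint_exists: "\<exists>S. S \<in> bounded_ops L K \<and> (\<forall>x\<in>K. \<forall>y\<in>L. cinner (T x) y = cinner x (S y))"
proof -
  define f where "f = (\<lambda>x. T (proj K x))"
  define S where "S = (\<lambda>y\<in>L. proj K (adjoint f y))"
  have f: "linear f" "operator_on UNIV L f"
    unfolding f_def
    using linear_operator_on_comp_proj[OF K T] operator_on_comp_proj[OF K T] by auto
  have re: "f x \<bullet> y = x \<bullet> adjoint f y" for x y
    using adjoint_works[OF f(1)] by simp
  have adj: "cinner x (S y) = cinner (T x) y" if "x \<in> K" "y \<in> L" for x y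
  proof -
    have "cinner x (S y) = cinner x (adjoint f y)"
      using that by (simp add: S_def cinner_proj_right[OF K])
    also have "\<dots> = cinner (f x) y"
      by (rule complex_eqI)
        (simp_all add: Re_cinner Im_cinner re operator_on_scaleC[OF f(2), symmetric])
    finally show ?thesis
      using that by (simp add: f_def proj_ident[OF K])
  qed
  have SK: "S y \<in> K" if "y \<in> L" for y
    using that by (simp add: S_def proj_in[OF K])
  have "operator_on L K S"
    unfolding operator_on_def
  proof (intro conjI ballI allI)
    show "S ` L \<subseteq> K"
      using SK by auto
  next
    fix x y assume "x \<in> L" "y \<in> L"
    then show "S (x + y) = S x + S y"
      by (intro eq_if_cinner_eq[OF K])
        (auto simp: SK adj cinner_add_right complex_vector.subspace_add[OF K]
          complex_vector.subspace_add[OF L])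
  next
    fix c x assume "x \<in> L"
    then show "S (c *\<^sub>C x) = c *\<^sub>C S x"
      by (intro eq_if_cinner_eq[OF K])
        (auto simp: SK adj cinner_scaleC_right complex_vector.subspace_scale[OF K]
          complex_vector.subspace_scale[OF L])
  qed
  moreover have "S \<in> extensional L"
    by (simp add: S_def)
  ultimately show ?thesis
    using adj by (auto simp: bounded_ops_iff[OF L])
qed

lemma hadjoint_eqI:
  assumes "S \<in> bounded_ops L K" "\<And>x y. \<lbrakk>x \<in> K; y \<in> L\<rbrakk> \<Longrightarrow> cinner (T x) y = cinner x (S y)"
  shows "hadjoint K L T = S"
  unfolding hadjoint_def
proof (rule the_equality)
  fix S' assume S': "S' \<in> bounded_ops L K \<and> (\<forall>x\<in>K. \<forall>y\<in>L. cinner (T x) y = cinner x (S' y))"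
  show "S' = S"
  proof (rule extensionalityI[of _ L])
    fix y assume "y \<in> L"
    then show "S' y = S y"
      using S' assms by (intro eq_if_cinner_eq[OF K]) (auto simp: bounded_ops_def)
  qed (use S' assms in \<open>auto simp: bounded_ops_iff[OF L]\<close>)
qed (use assms in auto)

lemma
  shows hadjoint_in_bounded_ops: "hadjoint K L T \<in> bounded_ops L K"
    and cinner_hadjoint_right: "\<lbrakk>x \<in> K; y \<in> L\<rbrakk> \<Longrightarrow> cinner x (hadjoint K L T y) = cinner (T x) y"
    and cinner_hadjoint_left: "\<lbrakk>x \<in> K; y \<in> L\<rbrakk> \<Longrightarrow> cinner (hadjoint K L T y) x = cinner y (T x)"
proof -
  obtain S where S: "S \<in> bounded_ops L K" "\<forall>x\<in>K. \<forall>y\<in>L. cinner (T x) y = cinner x (S y)"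
    using adjoint_exists by blast
  have *: "hadjoint K L T = S"
    using S by (intro hadjoint_eqI) auto
  show "hadjoint K L T \<in> bounded_ops L K"
    using S * by simp
  show "\<lbrakk>x \<in> K; y \<in> L\<rbrakk> \<Longrightarrow> cinner x (hadjoint K L T y) = cinner (T x) y"
    using S * by simp
  then show "\<lbrakk>x \<in> K; y \<in> L\<rbrakk> \<Longrightarrow> cinner (hadjoint K L T y) x = cinner y (T x)"
    by (metis cinner_commute)
qed

end

lemma compression_apply:
  fixes M :: "'h::{complex_inner, euclidean_space} set"
  assumes M: "complex_vector.subspace M"
  shows "compression M X = (\<lambda>x\<in>M. proj M (X x))"
proof -
  have "operator_on M UNIV (inclusion M)"
    using M by (auto simp: operator_on_def inclusion_def
        complex_vector.subspace_add complex_vector.subspace_scale)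
  moreover have "proj M \<in> bounded_ops UNIV M"
    by (auto simp: bounded_ops_iff operator_on_def proj_add[OF M] proj_scaleC[OF M] proj_in[OF M])
  ultimately have "hadjoint M UNIV (inclusion M) = proj M"
    using M by (intro hadjoint_eqI) (auto simp: inclusion_def cinner_proj_right)
  then show ?thesis
    unfolding compression_def compose_def inclusion_def by auto
qed

section \<open>Square roots of positive operators\<close>

lemma prod_linear_dvd_if_roots:
  fixes g :: "'a::field poly"
  assumes "finite Z" "\<And>z. z \<in> Z \<Longrightarrow> poly g z = 0"
  shows "(\<Prod>z\<in>Z. [:- z, 1:]) dvd g"
  using assms
proof (induction Z arbitrary: g rule: finite_induct)
  case (insert z Z)
  obtain h where h: "g = [:- z, 1:] * h"
    using insert.prems[of z] poly_eq_0_iff_dvd[of g z] by (auto elim: dvdE)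
  have "poly h y = 0" if "y \<in> Z" for y
    using insert.prems[of y] insert.hyps(2) that by (auto simp: h)
  then show ?case
    using insert.IH insert.hyps by (simp add: h mult_dvd_mono del: mult_pCons_left)
qed simp

lemma rsquarefree_dvd_if_roots:
  fixes p :: "complex poly"
  assumes "rsquarefree p" "\<And>z. poly p z = 0 \<Longrightarrow> poly g z = 0"
  shows "p dvd g"
proof -
  have "p \<noteq> 0"
    using assms(1) by (simp add: rsquarefree_def)
  have "p = smult (lead_coeff p) (\<Prod>z|poly p z = 0. [:- z, 1:])"
    using complex_poly_decompose_rsquarefree[OF assms(1)] by simp
  moreover have "(\<Prod>z|poly p z = 0. [:- z, 1:]) dvd g"
    using assms(2) poly_roots_finite[OF \<open>p \<noteq> 0\<close>] by (intro prod_linear_dvd_if_roots) auto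
  ultimately show ?thesis
    using \<open>p \<noteq> 0\<close> smult_dvd_iff[of "lead_coeff p"] by (metis leading_coeff_0_iff)
qed

lemma interpolation_exists:
  fixes f :: "'a::field \<Rightarrow> 'a"
  assumes "finite Z"
  shows "\<exists>q. \<forall>z\<in>Z. poly q z = f z"
  using assms
proof (induction Z rule: finite_induct)
  case (insert a Z)
  then obtain q where q: "\<forall>z\<in>Z. poly q z = f z"
    by blast
  define r where "r = (\<Prod>z\<in>Z. [:- z, 1:])"
  have r: "poly r a \<noteq> 0" "\<And>z. z \<in> Z \<Longrightarrow> poly r z = 0"
    using insert.hyps by (auto simp: r_def poly_prod)
  have "\<forall>z\<in>insert a Z. poly (q + smult ((f a - poly q a) / poly r a) r) z = f z"
    using r q by auto
  then show ?case
    by blast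
qed simp

lemma poly_map_poly_of_real: "poly (map_poly of_real q) (complex_of_real x) = of_real (poly q x)"
  by (induction q) (simp_all add: map_poly_pCons)

text \<open>
  Matrices of arbitrary size act on tuples of vectors, for which there is no single Euclidean
  type. So the vector space is abstract, and the sesquilinear form \<open>ip\<close> is an inner product only on the
  finite-dimensional subspace \<open>U\<close>.
\<close>
locale positive_operator = vector_space scale
  for scale :: "complex \<Rightarrow> 'v::ab_group_add \<Rightarrow> 'v" (infixr "\<star>" 75) +
  fixes ip :: "'v \<Rightarrow> 'v \<Rightarrow> complex" and U B :: "'v set" and T :: "'v \<Rightarrow> 'v"
  assumes T_add: "T (x + y) = T x + T y"
    and T_scale: "T (c \<star> x) = c \<star> T x"
    and finite_B: "finite B"
    and U_span: "U = span B"
    and T_U: "u \<in> U \<Longrightarrow> T u \<in> U"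
    and ip_commute: "ip x y = cnj (ip y x)"
    and ip_add_right: "ip x (y + z) = ip x y + ip x z"
    and ip_scale_right: "ip x (c \<star> y) = c * ip x y"
    and ip_self: "u \<in> U \<Longrightarrow> ip u u \<in> \<real>\<^sub>\<ge>\<^sub>0"
    and ip_definite: "\<lbrakk>u \<in> U; ip u u = 0\<rbrakk> \<Longrightarrow> u = 0"
    and T_nonneg: "u \<in> U \<Longrightarrow> ip u (T u) \<in> \<real>\<^sub>\<ge>\<^sub>0"
begin

lemma subspace_U: "subspace U"
  by (simp add: U_span subspace_span)

lemma T_zero [simp]: "T 0 = 0"
  using T_scale[of 0 0] by simp

lemma ip_add_left: "ip (x + y) z = ip x z + ip y z"
  by (metis ip_add_right ip_commute complex_cnj_add)

lemma ip_scale_left: "ip (c \<star> x) y = cnj c * ip x y"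
  by (metis ip_scale_right ip_commute complex_cnj_mult)

lemma ip_zero_right [simp]: "ip x 0 = 0"
  using ip_scale_right[of x 0 0] by simp

text \<open>Over the complex numbers a real quadratic form is symmetric, by polarization.\<close>
lemma T_symmetric:
  assumes "u \<in> U" "v \<in> U"
  shows "ip (T u) v = ip u (T v)"
proof -
  have real: "Im (ip w (T w)) = 0" if "w \<in> U" for w
    using T_nonneg[OF that] by (simp add: complex_nonneg_Reals_iff)
  have "Im (ip (u + c \<star> v) (T (u + c \<star> v))) = 0" for c
    using assms by (intro real subspace_add subspace_scale subspace_U)
  then have eq: "Im (c * ip u (T v) + cnj c * ip v (T u)) = 0" for c
    using real[OF assms(1)] real[OF assms(2)]
    by (simp add: T_add T_scale ip_add_left ip_add_right ip_scale_left ip_scale_right algebra_simps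
        flip: complex_norm_square mult.assoc)
  have "ip v (T u) = cnj (ip u (T v))"
    using eq[of 1] eq[of \<i>] by (simp add: complex_eq_iff)
  then show ?thesis
    by (metis ip_commute complex_cnj_cnj)
qed

text \<open>Evaluation of a polynomial at \<open>T\<close>, by Horner's scheme.\<close>
definition poly_op :: "complex poly \<Rightarrow> 'v \<Rightarrow> 'v"
  where "poly_op p u = fold_coeffs (\<lambda>a w. a \<star> u + T w) p 0"

lemma poly_op_0 [simp]: "poly_op 0 u = 0"
  by (simp add: poly_op_def)

lemma poly_op_pCons [simp]: "poly_op (pCons a p) u = a \<star> u + T (poly_op p u)"
  by (cases "p = 0 \<and> a = 0") (auto simp: poly_op_def)

lemma poly_op_add: "poly_op (p + q) u = poly_op p u + poly_op q u"
  by (induction p q rule: poly_induct2) (auto simp: T_add scale_left_distrib)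

lemma poly_op_smult: "poly_op (smult a p) u = a \<star> poly_op p u"
  by (induction p) (auto simp: T_scale scale_right_distrib)

lemma poly_op_mult: "poly_op (p * q) u = poly_op p (poly_op q u)"
  by (induction p) (auto simp: poly_op_add poly_op_smult)

lemma poly_op_zero_right [simp]: "poly_op p 0 = 0"
  by (induction p) auto

lemma poly_op_sum: "poly_op (\<Sum>i\<in>I. p i) u = (\<Sum>i\<in>I. poly_op (p i) u)"
  by (induction I rule: infinite_finite_induct) (auto simp: poly_op_add)

lemma poly_op_monom: "poly_op (monom a i) u = a \<star> (T ^^ i) u"
  by (induction i) (auto simp: monom_0 monom_Suc T_scale)

lemma poly_op_add_right: "poly_op p (u + v) = poly_op p u + poly_op p v"
  by (induction p) (auto simp: T_add scale_right_distrib)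

lemma poly_op_scale_right: "poly_op p (c \<star> u) = c \<star> poly_op p u"
  by (induction p) (auto simp: T_scale scale_right_distrib mult.commute)

lemma poly_op_in_U: "u \<in> U \<Longrightarrow> poly_op p u \<in> U"
  by (induction p) (auto intro: T_U subspace_0 subspace_add subspace_scale subspace_U)

lemma poly_op_commute:
  assumes "u \<in> U" "\<And>v. v \<in> U \<Longrightarrow> R v \<in> U" "\<And>v. v \<in> U \<Longrightarrow> R (T v) = T (R v)"
    and "\<And>v w. \<lbrakk>v \<in> U; w \<in> U\<rbrakk> \<Longrightarrow> R (v + w) = R v + R w"
    and "\<And>c v. v \<in> U \<Longrightarrow> R (c \<star> v) = c \<star> R v"
  shows "R (poly_op p u) = poly_op p (R u)"
proof (induction p)
  case 0
  then show ?case
    using assms(5)[of 0 0] subspace_0[OF subspace_U] by simp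
next
  case (pCons a p)
  then show ?case
    using assms by (simp add: poly_op_in_U T_U subspace_scale[OF subspace_U])
qed

lemma poly_op_symmetric:
  assumes "u \<in> U" "v \<in> U"
  shows "ip (poly_op (map_poly of_real q) u) v = ip u (poly_op (map_poly of_real q) v)"
  using assms(2)
proof (induction q arbitrary: v)
  case 0
  then show ?case
    using ip_commute[of 0 v] by simp
next
  case (pCons a q)
  let ?Q = "map_poly complex_of_real q"
  have "ip (T (poly_op ?Q u)) v = ip (poly_op ?Q u) (T v)"
    using assms(1) pCons.prems by (intro T_symmetric poly_op_in_U)
  also have "\<dots> = ip u (poly_op ?Q (T v))"
    using pCons.prems by (intro pCons.IH T_U)
  also have "poly_op ?Q (T v) = T (poly_op ?Q v)"
    using pCons.prems by (intro poly_op_commute[symmetric]) (auto simp: T_U T_add T_scale)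
  finally show ?case
    by (simp add: map_poly_pCons ip_add_left ip_add_right ip_scale_left ip_scale_right)
qed

text \<open>
  The vectors \<open>u\<close>, \<open>T u\<close>, \<open>T (T u)\<close>, and so on cannot all be independent; a linear dependence between
  them is the polynomial.
\<close>
lemma annihilating_poly_exists: "\<exists>p. p \<noteq> 0 \<and> poly_op p u = 0" if "u \<in> U"
proof -
  define f where "f = (\<lambda>i. (T ^^ i) u)"
  have fU: "f i \<in> U" for i
    using that by (induction i) (auto simp: f_def T_U)
  show ?thesis
  proof (cases "inj_on f {..card B}")
    case False
    then obtain i j where ij: "i \<noteq> j" "f i = f j"
      by (auto simp: inj_on_def)
    have "monom 1 i \<noteq> (monom 1 j :: complex poly)"
      using ij by (auto simp: poly_eq_iff)
    moreover have "poly_op (monom 1 i + smult (-1) (monom 1 j)) u = 0"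
      using ij(2) by (simp only: poly_op_add poly_op_smult poly_op_monom f_def) simp
    ultimately show ?thesis
      by (intro exI[of _ "monom 1 i + smult (-1) (monom 1 j)"]) auto
  next
    case inj: True
    have "dependent (f ` {..card B})"
    proof (rule ccontr)
      assume "\<not> dependent (f ` {..card B})"
      then have "card (f ` {..card B}) \<le> card B"
        using independent_span_bound[OF finite_B] fU by (auto simp: U_span)
      then show False
        by (simp add: card_image[OF inj])
    qed
    then obtain c v where c: "v \<in> f ` {..card B}" "c v \<noteq> 0"
        "(\<Sum>w\<in>f ` {..card B}. c w \<star> w) = 0"
      by (auto simp: dependent_finite)
    define p where "p = (\<Sum>i\<le>card B. monom (c (f i)) i)"
    obtain i where i: "i \<le> card B" "v = f i"
      using c(1) by auto
    have "coeff p i = c v"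
      using i by (simp add: p_def coeff_sum)
    then have "p \<noteq> 0"
      using c(2) by auto
    moreover have "poly_op p u = (\<Sum>i\<le>card B. c (f i) \<star> f i)"
      by (simp add: p_def poly_op_sum poly_op_monom f_def)
    then have "poly_op p u = 0"
      using c(3) by (simp add: sum.reindex[OF inj])
    ultimately show ?thesis
      by blast
  qed
qed

definition annihilates :: "complex poly \<Rightarrow> bool"
  where "annihilates p \<longleftrightarrow> (\<forall>u\<in>U. poly_op p u = 0)"

lemma annihilating_poly_exists_all: "\<exists>p. p \<noteq> 0 \<and> annihilates p"
proof -
  have "B \<subseteq> U"
    by (simp add: U_span span_superset)
  have "\<exists>p. p \<noteq> 0 \<and> (\<forall>b\<in>C. poly_op p b = 0)" if "C \<subseteq> B" for C
    using finite_subset[OF that finite_B] that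
  proof (induction C rule: finite_induct)
    case (insert b C)
    obtain p q where "p \<noteq> 0" "\<forall>b\<in>C. poly_op p b = 0" "q \<noteq> 0" "poly_op q b = 0"
      using insert annihilating_poly_exists[of b] \<open>B \<subseteq> U\<close> by auto
    moreover have "poly_op (q * p) b = poly_op (p * q) b"
      by (simp add: mult.commute)
    ultimately show ?case
      by (intro exI[of _ "q * p"]) (auto simp: poly_op_mult)
  qed (auto intro: exI[of _ 1])
  then obtain p where p: "p \<noteq> 0" "\<forall>b\<in>B. poly_op p b = 0"
    by blast
  have "poly_op p u = 0" if "u \<in> span B" for u
    using that
    by (induction rule: span_induct_alt) (auto simp: p poly_op_add_right poly_op_scale_right)
  then have "annihilates p"
    unfolding annihilates_def by (simp only: U_span) blast
  then show ?thesis
    using p(1) by blast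
qed

text \<open>
  A root \<open>z\<close> of an annihilating polynomial \<open>p\<close> of least degree is an eigenvalue, since \<open>p\<close>
  divided by the factor of \<open>z\<close> does not annihilate; so \<open>z\<close> is real and nonnegative. If \<open>z\<close> were a double root, some
  \<open>w = (T - z) v\<close> would be a nonzero eigenvector, but then
  \<open>\<langle>w, w\<rangle> = \<langle>v, (T - z) w\<rangle> = 0\<close>.
\<close>
lemma minimal_poly:
  obtains p where "rsquarefree p" "annihilates p"
    "\<And>z. poly p z = 0 \<Longrightarrow> z \<in> \<real>\<^sub>\<ge>\<^sub>0"
proof -
  obtain p where p: "p \<noteq> 0" "annihilates p"
    and min: "\<And>q. \<lbrakk>q \<noteq> 0; annihilates q\<rbrakk> \<Longrightarrow> degree p \<le> degree q"
    using ex_has_least_nat[of "\<lambda>p. p \<noteq> 0 \<and> annihilates p" _ degree] annihilating_poly_exists_all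
    by (metis (no_types, lifting))
  have eigen: "\<exists>u\<in>U. poly_op r u \<noteq> 0 \<and> T (poly_op r u) = z \<star> poly_op r u"
    if r: "p = [:- z, 1:] * r" for z r
  proof -
    have "r \<noteq> 0"
      using p r by auto
    then have "degree p = Suc (degree r)"
      unfolding r by (subst degree_mult_eq) auto
    then have "\<not> annihilates r"
      using min[OF \<open>r \<noteq> 0\<close>] by auto
    then obtain u where u: "u \<in> U" "poly_op r u \<noteq> 0"
      by (auto simp: annihilates_def)
    have "poly_op [:- z, 1:] (poly_op r u) = 0"
      using p(2) u(1) unfolding r annihilates_def by (simp only: poly_op_mult)
    then show ?thesis
      using u by (auto simp: algebra_simps)
  qed
  have "z \<in> \<real>\<^sub>\<ge>\<^sub>0 \<and> \<not> [:- z, 1:] ^ 2 dvd p" if root: "poly p z = 0" for z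
  proof
    obtain r where r: "p = [:- z, 1:] * r"
      using root poly_eq_0_iff_dvd[of p z] by (auto elim: dvdE)
    obtain u where u: "u \<in> U" "poly_op r u \<noteq> 0" "T (poly_op r u) = z \<star> poly_op r u"
      using eigen[OF r] by blast
    define w where "w = poly_op r u"
    have w: "w \<in> U" "w \<noteq> 0" "T w = z \<star> w"
      using u by (auto simp: w_def poly_op_in_U)
    have "z * ip w w \<in> \<real>\<^sub>\<ge>\<^sub>0" "ip w w \<in> \<real>\<^sub>\<ge>\<^sub>0" "ip w w \<noteq> 0"
      using T_nonneg[OF w(1)] ip_self[OF w(1)] ip_definite[OF w(1)] w(2,3)
      by (auto simp: ip_scale_right)
    then have "z * ip w w / ip w w \<in> \<real>\<^sub>\<ge>\<^sub>0"
      by (intro nonneg_Reals_divide_I) auto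
    then show z: "z \<in> \<real>\<^sub>\<ge>\<^sub>0"
      using \<open>ip w w \<noteq> 0\<close> by simp
    show "\<not> [:- z, 1:] ^ 2 dvd p"
    proof
      assume "[:- z, 1:] ^ 2 dvd p"
      then obtain s where s: "p = [:- z, 1:] * ([:- z, 1:] * s)"
        by (metis dvdE power2_eq_square mult.assoc)
      obtain u where u: "u \<in> U" "poly_op ([:- z, 1:] * s) u \<noteq> 0"
          "T (poly_op ([:- z, 1:] * s) u) = z \<star> poly_op ([:- z, 1:] * s) u"
        using eigen[OF s] by blast
      define v where "v = poly_op s u"
      define w where "w = T v - z \<star> v"
      have w: "w = poly_op ([:- z, 1:] * s) u"
        by (simp only: poly_op_mult v_def w_def) simp
      have U: "v \<in> U" "w \<in> U"
        using u(1) by (auto simp: v_def w poly_op_in_U)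
      have "cnj z = z"
        using z by (simp add: complex_eq_iff complex_nonneg_Reals_iff)
      have "w + z \<star> v = T v"
        by (simp add: w_def)
      then have "ip w w + z * ip v w = ip (T v) w"
        by (metis ip_add_left ip_scale_left \<open>cnj z = z\<close>)
      also have "\<dots> = ip v (T w)"
        using U by (rule T_symmetric)
      also have "\<dots> = z * ip v w"
        using u(3) unfolding w[symmetric] by (simp add: ip_scale_right)
      finally have "w = 0"
        using ip_definite U by simp
      then show False
        using u(2) w by simp
    qed
  qed
  note * = this
  have "order z p = 0 \<or> order z p = 1" for z
  proof (cases "poly p z = 0")
    case True
    then have "\<not> 2 \<le> order z p"
      using * order_divides[of z 2 p] p(1) by blast
    then show ?thesis
      by linarith
  qed (simp add: order_0I)
  then have "rsquarefree p"
    using p(1) by (simp add: rsquarefree_def)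
  then show ?thesis
    using that p(2) * by blast
qed

text \<open>
  A real polynomial \<open>q\<close> that interpolates the square root at the roots of the minimal polynomial
  satisfies \<open>q\<^sup>2 = x\<close> modulo that polynomial, which is squarefree.
\<close>
lemma square_root:
  obtains q :: "real poly"
  where "\<And>u. u \<in> U \<Longrightarrow> poly_op (map_poly of_real q) (poly_op (map_poly of_real q) u) = T u"
proof -
  obtain p where p: "rsquarefree p" "annihilates p" "\<And>z. poly p z = 0 \<Longrightarrow> z \<in> \<real>\<^sub>\<ge>\<^sub>0"
    using minimal_poly by blast
  define Z where "Z = Re ` {z. poly p z = 0}"
  have "finite Z"
    using p(1) poly_roots_finite[of p] by (simp add: Z_def rsquarefree_def)
  then obtain q where q: "\<forall>x\<in>Z. poly q x = sqrt x"
    using interpolation_exists by blast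
  define Q where "Q = map_poly complex_of_real q"
  have "p dvd Q * Q - [:0, 1:]"
  proof (rule rsquarefree_dvd_if_roots[OF p(1)])
    fix z assume z: "poly p z = 0"
    have zr: "z = complex_of_real (Re z)" "0 \<le> Re z"
      using p(3)[OF z] by (auto simp: complex_nonneg_Reals_iff complex_eq_iff)
    have "poly Q (complex_of_real (Re z)) = complex_of_real (sqrt (Re z))"
      using q z by (auto simp: Q_def poly_map_poly_of_real Z_def)
    then have "poly Q z * poly Q z = complex_of_real (sqrt (Re z) * sqrt (Re z))"
      using zr(1) by (metis of_real_mult)
    then show "poly (Q * Q - [:0, 1:]) z = 0"
      using zr by simp
  qed
  then obtain h where h: "Q * Q - [:0, 1:] = h * p"
    by (metis dvdE mult.commute)
  then have "Q * Q = h * p + [:0, 1:]"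
    by (simp add: algebra_simps)
  then have "poly_op Q (poly_op Q u) = T u" if "u \<in> U" for u
    using p(2) that by (simp add: poly_op_add poly_op_mult annihilates_def flip: poly_op_mult[of Q Q])
  then show ?thesis
    using that by (auto simp: Q_def)
qed

end

section \<open>Commutants as C*-algebras\<close>

text \<open>
  The algebra of operators on \<open>M\<close> that commute with \<open>\<R>\<close>. The record \<open>A\<close> is left
  abstract, and its addition is prescribed on the carrier only, so that the locale covers both all
  bounded operators (\<open>\<R> = {}\<close>) and the commutants constructed below.
\<close>
locale operator_algebra =
  fixes M :: "'h::{complex_inner, euclidean_space} set" and \<R> :: "('h \<Rightarrow> 'h) set"
    and A :: "('h \<Rightarrow> 'h) cstar" (structure)
  assumes M: "complex_vector.subspace M"
    and M_nonzero: "M \<noteq> {0}"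
    and R_operator: "R \<in> \<R> \<Longrightarrow> operator_on M M R"
    and R_adjoint: "R \<in> \<R> \<Longrightarrow> \<exists>R'\<in>\<R>. \<forall>u\<in>M. \<forall>v\<in>M. cinner (R u) v = cinner u (R' v)"
    and carrier_eq: "carrier A = {a \<in> bounded_ops M M. \<forall>R\<in>\<R>. \<forall>v\<in>M. a (R v) = R (a v)}"
    and mult_eq: "mult A = compose M"
    and one_eq: "\<one> = (\<lambda>v\<in>M. v)"
    and zero_eq: "\<zero> = (\<lambda>v\<in>M. 0)"
    and add_eq: "\<lbrakk>a \<in> carrier A; b \<in> carrier A\<rbrakk> \<Longrightarrow> a \<oplus> b = (\<lambda>v\<in>M. a v + b v)"
    and cscale_eq: "cscale A c a = (\<lambda>v\<in>M. c *\<^sub>C a v)"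
    and star_eq: "star A = hadjoint M M"
    and cnorm_eq: "cnorm A a = (SUP v\<in>M. norm (a v) / norm v)"
begin

lemma M_0: "0 \<in> M"
  and M_add: "\<lbrakk>u \<in> M; v \<in> M\<rbrakk> \<Longrightarrow> u + v \<in> M"
  and M_scaleC: "u \<in> M \<Longrightarrow> c *\<^sub>C u \<in> M"
  using M by (auto simp: complex_vector.subspace_def)

lemma carrier_iff: "a \<in> carrier A \<longleftrightarrow>
    a \<in> extensional M \<and> operator_on M M a \<and> (\<forall>R\<in>\<R>. \<forall>v\<in>M. a (R v) = R (a v))"
  by (auto simp: carrier_eq bounded_ops_iff[OF M])

lemma
  assumes "a \<in> carrier A"
  shows carrier_in: "v \<in> M \<Longrightarrow> a v \<in> M"
    and carrier_add: "\<lbrakk>u \<in> M; v \<in> M\<rbrakk> \<Longrightarrow> a (u + v) = a u + a v"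
    and carrier_scaleC: "v \<in> M \<Longrightarrow> a (c *\<^sub>C v) = c *\<^sub>C a v"
    and carrier_operator: "operator_on M M a"
    and carrier_commute: "\<lbrakk>R \<in> \<R>; v \<in> M\<rbrakk> \<Longrightarrow> a (R v) = R (a v)"
  using assms by (auto simp: carrier_iff operator_on_def)

lemma carrier_eqI:
  assumes "a \<in> carrier A" "b \<in> carrier A" "\<And>v. v \<in> M \<Longrightarrow> a v = b v"
  shows "a = b"
  using assms by (intro extensionalityI[of _ M]) (auto simp: carrier_iff)

lemma R_in: "\<lbrakk>R \<in> \<R>; v \<in> M\<rbrakk> \<Longrightarrow> R v \<in> M"
  using R_operator operator_on_in by blast

lemma R_add: "\<lbrakk>R \<in> \<R>; u \<in> M; v \<in> M\<rbrakk> \<Longrightarrow> R (u + v) = R u + R v"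
  using R_operator operator_on_add by blast

lemma R_scaleC: "\<lbrakk>R \<in> \<R>; v \<in> M\<rbrakk> \<Longrightarrow> R (c *\<^sub>C v) = c *\<^sub>C R v"
  using R_operator operator_on_scaleC by blast

lemma R_0: "R \<in> \<R> \<Longrightarrow> R 0 = 0"
  using R_scaleC[of R 0 0] M_0 by simp

lemma add_apply: "\<lbrakk>a \<in> carrier A; b \<in> carrier A; v \<in> M\<rbrakk> \<Longrightarrow> (a \<oplus> b) v = a v + b v"
  and mult_apply: "v \<in> M \<Longrightarrow> (a \<otimes> b) v = a (b v)"
  and one_apply: "v \<in> M \<Longrightarrow> \<one> v = v"
  and zero_apply: "v \<in> M \<Longrightarrow> \<zero> v = 0"
  and cscale_apply: "v \<in> M \<Longrightarrow> cscale A c a v = c *\<^sub>C a v"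
  by (simp_all add: add_eq mult_eq one_eq zero_eq cscale_eq compose_def)

lemma add_closed: "\<lbrakk>a \<in> carrier A; b \<in> carrier A\<rbrakk> \<Longrightarrow> a \<oplus> b \<in> carrier A"
  by (simp add: add_eq)
    (auto simp: carrier_iff operator_on_def image_subset_iff M_add M_scaleC R_in R_add
      complex_vector.scale_right_distrib)

lemma cscale_closed: "a \<in> carrier A \<Longrightarrow> cscale A c a \<in> carrier A"
  by (simp add: cscale_eq)
    (auto simp: carrier_iff operator_on_def image_subset_iff M_add M_scaleC R_in R_scaleC
      complex_vector.scale_right_distrib mult.commute)

lemma mult_closed: "\<lbrakk>a \<in> carrier A; b \<in> carrier A\<rbrakk> \<Longrightarrow> a \<otimes> b \<in> carrier A"
  by (simp add: mult_eq compose_def)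
    (auto simp: carrier_iff operator_on_def image_subset_iff M_add M_scaleC R_in)

lemma zero_closed: "\<zero> \<in> carrier A"
  by (auto simp: carrier_iff operator_on_def zero_eq M_0 R_0 M_add M_scaleC R_in)

lemma one_closed: "\<one> \<in> carrier A"
  by (auto simp: carrier_iff operator_on_def one_eq M_add M_scaleC R_in)

lemma
  assumes "a \<in> carrier A" "u \<in> M" "v \<in> M"
  shows cinner_star_right: "cinner u (star A a v) = cinner (a u) v"
    and cinner_star_left: "cinner (star A a v) u = cinner v (a u)"
  using assms
  by (auto simp: star_eq cinner_hadjoint_left[OF M M] cinner_hadjoint_right[OF M M] carrier_operator)

lemma star_closed:
  assumes a: "a \<in> carrier A"
  shows "star A a \<in> carrier A"
proof -
  have star: "star A a \<in> bounded_ops M M"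
    unfolding star_eq using a by (intro hadjoint_in_bounded_ops M carrier_operator)
  then have star_in: "v \<in> M \<Longrightarrow> star A a v \<in> M" for v
    by (auto simp: bounded_ops_def)
  have "star A a (R v) = R (star A a v)" if R: "R \<in> \<R>" and v: "v \<in> M" for R v
  proof (rule eq_if_cinner_eq[OF M])
    obtain R' where R': "R' \<in> \<R>" "\<And>u v. \<lbrakk>u \<in> M; v \<in> M\<rbrakk> \<Longrightarrow> cinner (R u) v = cinner u (R' v)"
      using R_adjoint[OF R] by blast
    have swap: "cinner u (R w) = cinner (R' u) w" if "u \<in> M" "w \<in> M" for u w
      using R'(2)[OF that(2,1)] by (metis cinner_commute)
    fix u assume u: "u \<in> M"
    have "cinner u (star A a (R v)) = cinner (R' (a u)) v"
      using a u v R R' by (simp add: cinner_star_right R_in swap carrier_in)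
    also have "\<dots> = cinner u (R (star A a v))"
      using a u v R R'
      by (simp add: cinner_star_right R_in swap star_in carrier_commute)
    finally show "cinner u (star A a (R v)) = cinner u (R (star A a v))" .
  qed (use R v in \<open>auto simp: R_in star_in\<close>)
  with star show ?thesis
    by (auto simp: carrier_eq)
qed

lemmas closed = add_closed mult_closed cscale_closed star_closed zero_closed one_closed
lemmas apply_simps = add_apply mult_apply one_apply zero_apply cscale_apply

lemma ring: "ring A"
proof (rule ringI)
  show "abelian_group A"
  proof (rule abelian_groupI)
    fix a assume a: "a \<in> carrier A"
    show "\<exists>b\<in>carrier A. b \<oplus> a = \<zero>"
      by (rule bexI[of _ "cscale A (-1) a"], rule carrier_eqI)
        (use a in \<open>auto simp: closed apply_simps\<close>)
  qed (auto intro!: carrier_eqI simp: closed apply_simps)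
  show "Group.monoid A"
    by (rule monoidI) (auto intro!: carrier_eqI simp: closed apply_simps carrier_in)
qed (auto intro!: carrier_eqI simp: closed apply_simps carrier_in carrier_add)

lemma minus_apply:
  assumes "a \<in> carrier A" "b \<in> carrier A"
  shows "a \<ominus> b \<in> carrier A" "v \<in> M \<Longrightarrow> (a \<ominus> b) v = a v - b v"
proof -
  interpret ring A
    by (rule ring)
  have "\<ominus> b = cscale A (-1) b"
    by (rule minus_equality, rule carrier_eqI) (use assms in \<open>auto simp: closed apply_simps\<close>)
  then show "a \<ominus> b \<in> carrier A" "v \<in> M \<Longrightarrow> (a \<ominus> b) v = a v - b v"
    using assms by (simp_all add: a_minus_def closed apply_simps)
qed

lemma finsum_apply:
  assumes "\<And>k. k \<in> I \<Longrightarrow> f k \<in> carrier A" "finite I"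
  shows "(\<Oplus>k\<in>I. f k) \<in> carrier A" "v \<in> M \<Longrightarrow> (\<Oplus>k\<in>I. f k) v = (\<Sum>k\<in>I. f k v)"
proof -
  interpret ring A
    by (rule ring)
  show "(\<Oplus>k\<in>I. f k) \<in> carrier A"
    using assms by (intro finsum_closed) auto
  show "(\<Oplus>k\<in>I. f k) v = (\<Sum>k\<in>I. f k v)" if "v \<in> M"
    using assms(2,1)
  proof (induction I rule: finite_induct)
    case empty
    then show ?case
      using that by (simp add: zero_apply)
  next
    case (insert k I)
    then have "(\<Oplus>k\<in>insert k I. f k) = f k \<oplus> (\<Oplus>k\<in>I. f k)"
      by (intro finsum_insert) auto
    moreover have "(\<Oplus>k\<in>I. f k) \<in> carrier A"
      using insert by (intro finsum_closed) auto
    ultimately show ?case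
      using insert that by (simp add: add_apply)
  qed
qed

lemma norm_apply_le:
  assumes "a \<in> carrier A" "v \<in> M"
  shows "norm (a v) \<le> cnorm A a * norm v"
proof -
  obtain b where b: "\<And>v. v \<in> M \<Longrightarrow> norm (a v) \<le> b * norm v"
    using operator_on_bounded[OF M carrier_operator[OF assms(1)]] by blast
  have "norm (a v) / norm v \<le> \<bar>b\<bar>" if "v \<in> M" for v
  proof (cases "v = 0")
    case False
    then have "norm (a v) / norm v \<le> b"
      using b[OF that] by (simp add: divide_le_eq)
    then show ?thesis
      by linarith
  qed simp
  then have "bdd_above ((\<lambda>v. norm (a v) / norm v) ` M)"
    by (intro bdd_aboveI2[of _ _ "\<bar>b\<bar>"])
  then have "norm (a v) / norm v \<le> cnorm A a"
    unfolding cnorm_eq using assms(2) by (intro cSUP_upper)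
  moreover have "a v = 0" if "v = 0"
    using carrier_scaleC[OF assms(1) M_0, of 0] that by simp
  ultimately show ?thesis
    by (cases "v = 0") (auto simp: divide_le_eq)
qed

lemma cnorm_le:
  assumes "0 \<le> b" "\<And>v. v \<in> M \<Longrightarrow> norm (a v) \<le> b * norm v"
  shows "cnorm A a \<le> b"
  unfolding cnorm_eq
proof (rule cSUP_least)
  show "norm (a v) / norm v \<le> b" if "v \<in> M" for v
    using assms(1) assms(2)[OF that] by (cases "v = 0") (auto simp: divide_le_eq)
qed (use M_0 in auto)

lemma cnorm_nonneg:
  assumes "a \<in> carrier A"
  shows "0 \<le> cnorm A a"
proof -
  obtain v where "v \<in> M" "v \<noteq> 0"
    using M_nonzero M_0 by blast
  then have "0 \<le> cnorm A a * norm v"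
    using norm_apply_le[OF assms] norm_ge_zero order_trans by blast
  then show ?thesis
    using \<open>v \<noteq> 0\<close> by (simp add: zero_le_mult_iff)
qed

lemma cnorm_cscale_le:
  assumes "a \<in> carrier A"
  shows "cnorm A (cscale A c a) \<le> cmod c * cnorm A a"
  using assms norm_apply_le[OF assms]
  by (intro cnorm_le) (auto simp: cnorm_nonneg cscale_apply norm_scaleC mult.assoc mult_left_mono)

lemma cnorm_mult_le:
  assumes "a \<in> carrier A" "b \<in> carrier A"
  shows "cnorm A (a \<otimes> b) \<le> cnorm A a * cnorm A b"
proof (rule cnorm_le)
  fix v assume v: "v \<in> M"
  have "norm (a (b v)) \<le> cnorm A a * norm (b v)"
    using assms(1) carrier_in[OF assms(2) v] by (rule norm_apply_le)
  also have "\<dots> \<le> cnorm A a * (cnorm A b * norm v)"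
    using norm_apply_le[OF assms(2) v] cnorm_nonneg[OF assms(1)] by (rule mult_left_mono)
  finally show "norm ((a \<otimes> b) v) \<le> cnorm A a * cnorm A b * norm v"
    using v by (simp add: mult_apply mult.assoc)
qed (use assms in \<open>simp add: cnorm_nonneg\<close>)

lemma cnorm_star_mult:
  assumes a: "a \<in> carrier A"
  shows "(cnorm A a)\<^sup>2 \<le> cnorm A (star A a \<otimes> a)"
proof -
  let ?c = "cnorm A (star A a \<otimes> a)"
  have c: "star A a \<otimes> a \<in> carrier A" "0 \<le> ?c"
    using a by (auto simp: closed cnorm_nonneg)
  have "cnorm A a \<le> sqrt ?c"
  proof (rule cnorm_le)
    fix v assume v: "v \<in> M"
    have "complex_of_real ((norm (a v))\<^sup>2) = cinner v ((star A a \<otimes> a) v)"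
      using a v by (simp add: mult_apply cinner_star_right carrier_in cinner_self)
    then have "(norm (a v))\<^sup>2 = v \<bullet> (star A a \<otimes> a) v"
      unfolding Re_cinner[symmetric] by (metis Re_complex_of_real)
    also have "\<dots> \<le> norm v * norm ((star A a \<otimes> a) v)"
      by (rule norm_cauchy_schwarz)
    also have "\<dots> \<le> norm v * (?c * norm v)"
      using norm_apply_le[OF c(1) v] by (intro mult_left_mono) auto
    also have "\<dots> = (sqrt ?c * norm v)\<^sup>2"
      using c(2) by (simp add: power_mult_distrib power2_eq_square)
    finally show "norm (a v) \<le> sqrt ?c * norm v"
      by (rule power2_le_imp_le) (use c in simp)
  qed (use c in simp)
  then have "(cnorm A a)\<^sup>2 \<le> (sqrt ?c)\<^sup>2"
    by (intro power_mono cnorm_nonneg a)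
  then show ?thesis
    by (simp only: real_sqrt_pow2[OF c(2)])
qed

lemma cnorm_star_le:
  assumes a: "a \<in> carrier A"
  shows "cnorm A a \<le> cnorm A (star A a)"
proof -
  have "cnorm A a * cnorm A a \<le> cnorm A (star A a) * cnorm A a"
    using cnorm_star_mult[OF a] cnorm_mult_le[OF star_closed[OF a] a]
    by (simp add: power2_eq_square)
  then have "cnorm A a \<le> cnorm A (star A a)" if "0 < cnorm A a"
    using that by (rule mult_right_le_imp_le)
  then show ?thesis
    using cnorm_nonneg[OF a] cnorm_nonneg[OF star_closed[OF a]] by linarith
qed

lemma star_star:
  assumes a: "a \<in> carrier A"
  shows "star A (star A a) = a"
proof (rule carrier_eqI)
  fix v assume v: "v \<in> M"
  show "star A (star A a) v = a v"
    using a v by (intro eq_if_cinner_eq[OF M])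
      (simp_all add: carrier_in star_closed cinner_star_right cinner_star_left)
qed (use a in \<open>simp_all add: star_closed\<close>)

text \<open>
  All conditions that define the carrier are equations between values of the operator, so they
  survive pointwise limits.
\<close>
lemma carrier_limit:
  assumes "\<And>n. \<sigma> n \<in> carrier A" "\<And>v. v \<in> M \<Longrightarrow> (\<lambda>n. \<sigma> n v) \<longlonglongrightarrow> a v" "a \<in> extensional M"
  shows "a \<in> carrier A"
proof -
  have lim: "a v = w" if "v \<in> M" "(\<lambda>n. \<sigma> n v) \<longlonglongrightarrow> w" for v w
    by (rule LIMSEQ_unique[OF assms(2)[OF that(1)] that(2)])
  have tendsto_op: "(\<lambda>n. f (\<sigma> n v)) \<longlonglongrightarrow> f (a v)" if "linear f" "v \<in> M" for f :: "'h \<Rightarrow> 'h" and v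
    using linear_conv_bounded_linear[THEN iffD1, OF that(1)] assms(2)[OF that(2)]
    by (rule bounded_linear.tendsto)
  have in_M: "a v \<in> M" if "v \<in> M" for v
  proof (rule closed_sequentially)
    show "closed M"
      by (rule closed_subspace[OF subspace_if_complex_subspace[OF M]])
    show "\<sigma> n v \<in> M" for n
      using assms(1) that by (rule carrier_in)
  qed (rule assms(2)[OF that])
  have "a (u + v) = a u + a v" if "u \<in> M" "v \<in> M" for u v
  proof (rule lim)
    show "(\<lambda>n. \<sigma> n (u + v)) \<longlonglongrightarrow> a u + a v"
      unfolding carrier_add[OF assms(1) that] by (intro tendsto_add assms(2) that)
  qed (intro M_add that)
  moreover have "a (c *\<^sub>C v) = c *\<^sub>C a v" if "v \<in> M" for c v
  proof (rule lim)
    have "linear ((*\<^sub>C) c :: 'h \<Rightarrow> 'h)"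
      by (rule linearI) (simp_all add: complex_vector.scale_right_distrib scaleR_eq_scaleC mult.commute)
    then show "(\<lambda>n. \<sigma> n (c *\<^sub>C v)) \<longlonglongrightarrow> c *\<^sub>C a v"
      unfolding carrier_scaleC[OF assms(1) that] by (rule tendsto_op) (rule that)
  qed (intro M_scaleC that)
  moreover have "a (R v) = R (a v)" if "R \<in> \<R>" "v \<in> M" for R v
  proof (rule lim)
    have "(\<lambda>n. R (proj M (\<sigma> n v))) \<longlonglongrightarrow> R (proj M (a v))"
      using that by (intro tendsto_op linear_operator_on_comp_proj[OF M R_operator])
    then show "(\<lambda>n. \<sigma> n (R v)) \<longlonglongrightarrow> R (a v)"
      unfolding carrier_commute[OF assms(1) that]
      by (simp only: proj_ident[OF M] carrier_in[OF assms(1) that(2)] in_M[OF that(2)])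
  qed (rule R_in[OF that])
  ultimately show ?thesis
    unfolding carrier_iff operator_on_def using in_M assms(3) by blast
qed

lemma complete:
  assumes "Metric_space (carrier A) (\<lambda>a b. cnorm A (a \<ominus> b))"
  shows "Metric_space.mcomplete (carrier A) (\<lambda>a b. cnorm A (a \<ominus> b))"
proof -
  interpret Metric_space "carrier A" "\<lambda>a b. cnorm A (a \<ominus> b)"
    by (rule assms)
  have "\<exists>a. limitin mtopology \<sigma> a sequentially" if \<sigma>: "MCauchy \<sigma>" for \<sigma>
  proof -
    have \<sigma>A: "\<sigma> n \<in> carrier A" for n
      using \<sigma> by (auto simp: MCauchy_def)
    have bound: "norm (\<sigma> n v - \<sigma> m v) \<le> e * norm v"
      if "cnorm A (\<sigma> n \<ominus> \<sigma> m) < e" "v \<in> M" for n m e v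
    proof -
      have "norm ((\<sigma> n \<ominus> \<sigma> m) v) \<le> cnorm A (\<sigma> n \<ominus> \<sigma> m) * norm v"
        by (rule norm_apply_le[OF minus_apply(1)[OF \<sigma>A \<sigma>A] that(2)])
      also have "\<dots> \<le> e * norm v"
        using that(1) by (intro mult_right_mono) auto
      finally show ?thesis
        using that(2) by (simp add: minus_apply \<sigma>A)
    qed
    have ex: "\<exists>N. \<forall>n\<ge>N. \<forall>m\<ge>N. \<forall>v\<in>M. norm (\<sigma> n v - \<sigma> m v) \<le> e * norm v" if "e > 0" for e
      using \<sigma> bound that unfolding MCauchy_def by meson
    have "convergent (\<lambda>n. \<sigma> n v)" if v: "v \<in> M" for v
    proof (rule Cauchy_convergent, rule CauchyI)
      fix e :: real assume "e > 0"
      (* The summand 1 covers the case v = 0. *)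
      define d where "d = e / (norm v + 1)"
      have d: "d > 0" "d * norm v < e"
        using \<open>e > 0\<close> by (auto simp: d_def divide_less_eq add_nonneg_pos mult_less_cancel_left)
      show "\<exists>N. \<forall>m\<ge>N. \<forall>n\<ge>N. norm (\<sigma> m v - \<sigma> n v) < e"
        using ex[OF d(1)] v d(2) by (meson order_le_less_trans)
    qed
    then obtain l where l: "\<And>v. v \<in> M \<Longrightarrow> (\<lambda>n. \<sigma> n v) \<longlonglongrightarrow> l v"
      unfolding convergent_def by metis
    define a where "a = restrict l M"
    have lim: "(\<lambda>n. \<sigma> n v) \<longlonglongrightarrow> a v" if "v \<in> M" for v
      using l that by (simp add: a_def)
    have "a \<in> extensional M"
      unfolding a_def by (rule restrict_extensional)
    with \<sigma>A lim have a: "a \<in> carrier A"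
      by (rule carrier_limit)
    have "\<exists>N. \<forall>n\<ge>N. cnorm A (\<sigma> n \<ominus> a) < e" if "e > 0" for e
    proof -
      obtain N where N: "\<And>n m v. \<lbrakk>n \<ge> N; m \<ge> N; v \<in> M\<rbrakk> \<Longrightarrow> norm (\<sigma> n v - \<sigma> m v) \<le> e / 2 * norm v"
        using ex[of "e / 2"] \<open>e > 0\<close> by auto
      have "cnorm A (\<sigma> n \<ominus> a) \<le> e / 2" if n: "n \<ge> N" for n
      proof (rule cnorm_le)
        fix v assume v: "v \<in> M"
        have "(\<lambda>m. norm (\<sigma> n v - \<sigma> m v)) \<longlonglongrightarrow> norm (\<sigma> n v - a v)"
          by (intro tendsto_intros lim v)
        then have "norm (\<sigma> n v - a v) \<le> e / 2 * norm v"
          by (rule LIMSEQ_le_const2) (use N n v in auto)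
        then show "norm ((\<sigma> n \<ominus> a) v) \<le> e / 2 * norm v"
          using v by (simp add: minus_apply \<sigma>A a)
      qed (use \<open>e > 0\<close> in simp)
      then show ?thesis
        using \<open>e > 0\<close> by (intro exI[of _ N]) fastforce
    qed
    then show ?thesis
      using a \<sigma>A by (auto simp: limit_metric_sequentially)
  qed
  then show ?thesis
    by (auto simp: mcomplete_def)
qed

text \<open>
  The hypothesis concerns elements outside of the carrier: a \<open>Metric_space\<close> has a distance that is
  symmetric and nonnegative on the entire type.
\<close>
lemma cstar_algebra_if_metric:
  assumes "Metric_space (carrier A) (\<lambda>a b. cnorm A (a \<ominus> b))"
  shows "cstar_algebra A"
proof -
  interpret ring A
    by (rule ring)
  show ?thesis
  proof
    obtain v where "v \<in> M" "v \<noteq> 0"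
      using M_nonzero M_0 by blast
    then show "\<one> \<noteq> \<zero>"
      by (auto simp: one_eq zero_eq fun_eq_iff)
  next
    fix a b c assume ab: "a \<in> carrier A" "b \<in> carrier A"
    show "star A (a \<oplus> b) = star A a \<oplus> star A b"
      by (rule carrier_eqI, simp_all add: closed ab, rule eq_if_cinner_eq[OF M])
        (auto simp: carrier_in closed ab cinner_star_right apply_simps M_add
          cinner_add_left cinner_add_right)
    show "star A (a \<otimes> b) = star A b \<otimes> star A a"
      by (rule carrier_eqI, simp_all add: closed ab, rule eq_if_cinner_eq[OF M])
        (auto simp: carrier_in closed ab cinner_star_right apply_simps)
    show "cnorm A (a \<oplus> b) \<le> cnorm A a + cnorm A b"
    proof (rule cnorm_le)
      fix v assume v: "v \<in> M"
      have "norm (a v + b v) \<le> norm (a v) + norm (b v)"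
        by (rule norm_triangle_ineq)
      also have "\<dots> \<le> (cnorm A a + cnorm A b) * norm v"
        using norm_apply_le[OF ab(1) v] norm_apply_le[OF ab(2) v] by (simp add: distrib_right)
      finally show "norm ((a \<oplus> b) v) \<le> (cnorm A a + cnorm A b) * norm v"
        using ab v by (simp add: add_apply)
    qed (use ab in \<open>simp add: cnorm_nonneg\<close>)
    show "cnorm A (a \<otimes> b) \<le> cnorm A a * cnorm A b"
      using ab by (rule cnorm_mult_le)
  next
    fix a c assume a: "a \<in> carrier A"
    show "star A (cscale A c a) = cscale A (cnj c) (star A a)"
      by (rule carrier_eqI, simp_all add: closed a, rule eq_if_cinner_eq[OF M])
        (auto simp: carrier_in closed a cinner_star_right apply_simps M_scaleC
          cinner_scaleC_left cinner_scaleC_right)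
    show "cnorm A a = 0 \<longleftrightarrow> a = \<zero>"
    proof
      assume "cnorm A a = 0"
      then show "a = \<zero>"
        using norm_apply_le[OF a] by (intro carrier_eqI a zero_closed) (simp add: zero_apply)
    next
      assume "a = \<zero>"
      then have "cnorm A a \<le> 0"
        by (intro cnorm_le) (auto simp: zero_apply)
      then show "cnorm A a = 0"
        using cnorm_nonneg[OF a] by simp
    qed
    show "cnorm A (cscale A c a) = cmod c * cnorm A a"
    proof (rule antisym)
      show "cmod c * cnorm A a \<le> cnorm A (cscale A c a)"
      proof (cases "c = 0")
        case False
        have "cscale A (1 / c) (cscale A c a) = a"
          by (rule carrier_eqI) (use a False in \<open>auto simp: closed cscale_apply\<close>)
        then have "cnorm A a \<le> cmod (1 / c) * cnorm A (cscale A c a)"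
          using cnorm_cscale_le[OF cscale_closed[OF a], of "1 / c" c] by simp
        then show ?thesis
          using False by (simp add: norm_divide field_simps)
      qed (use a in \<open>simp add: cnorm_nonneg closed\<close>)
    qed (rule cnorm_cscale_le[OF a])
    show "cnorm A (star A a \<otimes> a) = (cnorm A a)\<^sup>2"
    proof (rule antisym)
      have "cnorm A (star A a) \<le> cnorm A a"
        using cnorm_star_le[OF star_closed[OF a]] by (simp add: star_star a)
      then have "cnorm A (star A a) * cnorm A a \<le> cnorm A a * cnorm A a"
        by (intro mult_right_mono cnorm_nonneg a)
      then show "cnorm A (star A a \<otimes> a) \<le> (cnorm A a)\<^sup>2"
        using cnorm_mult_le[OF star_closed[OF a] a] by (simp add: power2_eq_square)
    qed (rule cnorm_star_mult[OF a])
  next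
    show "Metric_space.mcomplete (carrier A) (\<lambda>x y. cnorm A (x \<ominus> y))"
      by (rule complete[OF assms])
  qed (auto intro!: carrier_eqI simp: closed apply_simps carrier_in carrier_scaleC cnorm_nonneg
      star_star complex_vector.scale_right_distrib complex_vector.scale_left_distrib)
qed

end

lemma operator_algebra_bop:
  fixes M :: "'h::{complex_inner, euclidean_space} set"
  assumes "complex_vector.subspace M" "M \<noteq> {0}"
  shows "operator_algebra M {} (bop M)"
  by unfold_locales (auto simp: assms bop_def)

text \<open>
  Completeness in \<open>cstar_algebra\<close> refers to a \<open>Metric_space\<close>, whose distance has to be symmetric on the entire
  type. For the addition of \<open>bop\<close> the additive inverse of a function outside of the carrier is
  unspecified, and \<open>cnorm (a \<ominus> b)\<close> need not be symmetric. Reading such functions as 0 repairs this.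
\<close>
definition commutant :: "'h::{complex_inner, euclidean_space} set \<Rightarrow> ('h \<Rightarrow> 'h) set \<Rightarrow> ('h \<Rightarrow> 'h) cstar"
  where "commutant M \<R> =
    (let C = {a \<in> bounded_ops M M. \<forall>R\<in>\<R>. \<forall>v\<in>M. a (R v) = R (a v)};
         clip = (\<lambda>a v. if a \<in> C then a v else 0)
     in (bop M)\<lparr>carrier := C, add := (\<lambda>a b. \<lambda>v\<in>M. clip a v + clip b v)\<rparr>)"

lemma
  fixes M :: "'h::{complex_inner, euclidean_space} set"
  assumes "complex_vector.subspace M" "M \<noteq> {0}"
    and "\<And>R. R \<in> \<R> \<Longrightarrow> operator_on M M R"
    and "\<And>R. R \<in> \<R> \<Longrightarrow> \<exists>R'\<in>\<R>. \<forall>u\<in>M. \<forall>v\<in>M. cinner (R u) v = cinner u (R' v)"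
  shows operator_algebra_commutant: "operator_algebra M \<R> (commutant M \<R>)"
    and cstar_algebra_commutant: "cstar_algebra (commutant M \<R>)"
proof -
  let ?A = "commutant M \<R>"
  show alg: "operator_algebra M \<R> ?A"
    by unfold_locales (auto simp: assms commutant_def bop_def Let_def)
  interpret operator_algebra M \<R> ?A
    by (rule alg)
  interpret ring ?A
    by (rule ring)
  define clip where "clip = (\<lambda>a. if a \<in> carrier ?A then a else \<zero>\<^bsub>?A\<^esub>)"
  have clip_closed: "clip a \<in> carrier ?A" for a
    by (simp add: clip_def)
  have add_clip: "a \<oplus>\<^bsub>?A\<^esub> b = clip a \<oplus>\<^bsub>?A\<^esub> clip b" for a b
  proof -
    have "a \<oplus>\<^bsub>?A\<^esub> b = (\<lambda>v\<in>M. (if a \<in> carrier ?A then a v else 0) + (if b \<in> carrier ?A then b v else 0))"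
      by (simp add: commutant_def Let_def)
    also have "\<dots> = clip a \<oplus>\<^bsub>?A\<^esub> clip b"
      unfolding add_eq[OF clip_closed clip_closed]
      by (rule restrict_ext) (simp add: clip_def zero_apply)
    finally show ?thesis .
  qed
  (* The additive inverse is a definite description that sees its argument only through sums. *)
  have minus: "\<ominus>\<^bsub>?A\<^esub> b = \<ominus>\<^bsub>?A\<^esub> clip b" for b
  proof -
    have "b \<oplus>\<^bsub>?A\<^esub> z = clip b \<oplus>\<^bsub>?A\<^esub> z" "z \<oplus>\<^bsub>?A\<^esub> b = z \<oplus>\<^bsub>?A\<^esub> clip b" for z
      by (metis add_clip clip_def clip_closed)+
    then show ?thesis
      by (simp add: a_inv_def m_inv_def)
  qed
  have diff: "a \<ominus>\<^bsub>?A\<^esub> b = clip a \<ominus>\<^bsub>?A\<^esub> clip b" for a b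
    unfolding a_minus_def by (metis add_clip minus clip_def clip_closed)
  have clip_ident: "clip a = a" if "a \<in> carrier ?A" for a
    using that by (simp add: clip_def)
  have norm_diff: "norm (a v - b v) \<le> cnorm ?A (a \<ominus>\<^bsub>?A\<^esub> b) * norm v"
    if "a \<in> carrier ?A" "b \<in> carrier ?A" "v \<in> M" for a b v
    using norm_apply_le[OF minus_apply(1)[OF that(1,2)] that(3)] minus_apply(2)[OF that] by simp
  have norm_swap: "cnorm ?A (a \<ominus>\<^bsub>?A\<^esub> b) \<le> cnorm ?A (b \<ominus>\<^bsub>?A\<^esub> a)"
    if "a \<in> carrier ?A" "b \<in> carrier ?A" for a b
    using that norm_diff[OF that(2,1)]
    by (intro cnorm_le cnorm_nonneg minus_apply) (simp_all add: minus_apply norm_minus_commute)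
  show "cstar_algebra ?A"
  proof (rule cstar_algebra_if_metric, unfold_locales)
    fix a b
    show "0 \<le> cnorm ?A (a \<ominus>\<^bsub>?A\<^esub> b)"
      unfolding diff[of a b] by (intro cnorm_nonneg minus_apply clip_closed)
    show "cnorm ?A (a \<ominus>\<^bsub>?A\<^esub> b) = cnorm ?A (b \<ominus>\<^bsub>?A\<^esub> a)"
      unfolding diff[of a b] diff[of b a] by (intro antisym norm_swap clip_closed)
  next
    fix a b assume ab: "a \<in> carrier ?A" "b \<in> carrier ?A"
    show "cnorm ?A (a \<ominus>\<^bsub>?A\<^esub> b) = 0 \<longleftrightarrow> a = b"
    proof
      assume "cnorm ?A (a \<ominus>\<^bsub>?A\<^esub> b) = 0"
      then show "a = b"
        using norm_diff[OF ab] by (intro carrier_eqI ab) auto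
    next
      assume "a = b"
      then have "cnorm ?A (a \<ominus>\<^bsub>?A\<^esub> b) \<le> 0"
        using ab by (intro cnorm_le) (auto simp: minus_apply)
      then show "cnorm ?A (a \<ominus>\<^bsub>?A\<^esub> b) = 0"
        using cnorm_nonneg[OF minus_apply(1)[OF ab]] by simp
    qed
    fix c assume c: "c \<in> carrier ?A"
    show "cnorm ?A (a \<ominus>\<^bsub>?A\<^esub> c) \<le> cnorm ?A (a \<ominus>\<^bsub>?A\<^esub> b) + cnorm ?A (b \<ominus>\<^bsub>?A\<^esub> c)"
    proof (rule cnorm_le)
      fix v assume v: "v \<in> M"
      have "norm (a v - c v) \<le> norm (a v - b v) + norm (b v - c v)"
        using norm_triangle_ineq[of "a v - b v" "b v - c v"] by simp
      also have "\<dots> \<le> (cnorm ?A (a \<ominus>\<^bsub>?A\<^esub> b) + cnorm ?A (b \<ominus>\<^bsub>?A\<^esub> c)) * norm v"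
        using norm_diff ab c v by (simp add: distrib_right add_mono)
      finally show "norm ((a \<ominus>\<^bsub>?A\<^esub> c) v)
          \<le> (cnorm ?A (a \<ominus>\<^bsub>?A\<^esub> b) + cnorm ?A (b \<ominus>\<^bsub>?A\<^esub> c)) * norm v"
        using ab c v by (simp add: minus_apply)
    qed (use ab c in \<open>simp add: cnorm_nonneg minus_apply\<close>)
  qed
qed

section \<open>Positivity of operator matrices\<close>

definition mat_form :: "nat \<Rightarrow> (nat \<times> nat \<Rightarrow> 'h \<Rightarrow> 'h) \<Rightarrow> (nat \<Rightarrow> 'h::complex_inner) \<Rightarrow> complex"
  where "mat_form n X v = (\<Sum>i<n. \<Sum>j<n. cinner (v i) (X (i, j) (v j)))"

definition unit_vec :: "nat \<Rightarrow> 'h::zero \<Rightarrow> nat \<Rightarrow> 'h"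
  where "unit_vec j x = (\<lambda>i. if i = j then x else 0)"

lemma unit_vec_add: "unit_vec j (x + y) = unit_vec j x + unit_vec j (y :: 'h::monoid_add)"
  by (auto simp: unit_vec_def fun_eq_iff)

lemma unit_vec_scaleC: "unit_vec j (c *\<^sub>C x) = (\<lambda>i. c *\<^sub>C unit_vec j x i)"
  by (auto simp: unit_vec_def fun_eq_iff)

lemma sum_fun_apply: "(\<Sum>i\<in>I. f i) x = (\<Sum>i\<in>I. f i x)"
  by (induction I rule: infinite_finite_induct) auto

interpretation tuple_space: vector_space "\<lambda>c f i. c *\<^sub>C (f i :: 'h::complex_inner)"
  by unfold_locales
    (auto simp: fun_eq_iff complex_vector.scale_right_distrib complex_vector.scale_left_distrib)

lemma nonneg_Reals_sum: "(\<And>i. i \<in> I \<Longrightarrow> f i \<in> \<real>\<^sub>\<ge>\<^sub>0) \<Longrightarrow> (\<Sum>i\<in>I. f i :: complex) \<in> \<real>\<^sub>\<ge>\<^sub>0"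
  by (induction I rule: infinite_finite_induct) (auto intro: nonneg_Reals_add_I)

lemma cinner_self_nonneg: "cinner x x \<in> \<real>\<^sub>\<ge>\<^sub>0"
  by (simp add: cinner_self)

context operator_algebra
begin

lemma mat_carrier_entry:
  "\<lbrakk>X \<in> carrier (mat_algebra n A); i < n; j < n\<rbrakk> \<Longrightarrow> X (i, j) \<in> carrier A"
  by (auto simp: mat_algebra_def)

lemma star_mult_entry:
  assumes Y: "Y \<in> carrier (mat_algebra n A)" and "i < n" "j < n"
  shows "(star (mat_algebra n A) Y \<otimes>\<^bsub>mat_algebra n A\<^esub> Y) (i, j) \<in> carrier A"
    and "\<lbrakk>u \<in> M; v \<in> M\<rbrakk> \<Longrightarrow>
      cinner u ((star (mat_algebra n A) Y \<otimes>\<^bsub>mat_algebra n A\<^esub> Y) (i, j) v)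
        = (\<Sum>k<n. cinner (Y (k, i) u) (Y (k, j) v))"
proof -
  define f where "f = (\<lambda>k. (if k < n then star A (Y (k, i)) else undefined) \<otimes> Y (k, j))"
  have eq: "(star (mat_algebra n A) Y \<otimes>\<^bsub>mat_algebra n A\<^esub> Y) (i, j) = (\<Oplus>k\<in>{..<n}. f k)"
    unfolding f_def using assms(2,3) by (simp add: mat_algebra_def cong: if_cong)
  have f: "f k \<in> carrier A" if "k \<in> {..<n}" for k
    using that assms by (simp add: f_def mult_closed star_closed mat_carrier_entry)
  show "(star (mat_algebra n A) Y \<otimes>\<^bsub>mat_algebra n A\<^esub> Y) (i, j) \<in> carrier A"
    unfolding eq by (rule finsum_apply(1)[OF f]) auto
  assume uv: "u \<in> M" "v \<in> M"
  have "(\<Oplus>k\<in>{..<n}. f k) v = (\<Sum>k<n. f k v)"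
    using f finite_lessThan uv(2) by (rule finsum_apply(2))
  moreover have "cinner u (f k v) = cinner (Y (k, i) u) (Y (k, j) v)" if "k < n" for k
    using that assms uv by (simp add: f_def mult_apply cinner_star_right carrier_in mat_carrier_entry)
  ultimately show "cinner u ((star (mat_algebra n A) Y \<otimes>\<^bsub>mat_algebra n A\<^esub> Y) (i, j) v)
      = (\<Sum>k<n. cinner (Y (k, i) u) (Y (k, j) v))"
    by (simp add: eq cinner_sum_right)
qed

lemma mat_form_star_mult:
  assumes "Y \<in> carrier (mat_algebra n A)" "\<And>i. i < n \<Longrightarrow> v i \<in> M"
  shows "mat_form n (star (mat_algebra n A) Y \<otimes>\<^bsub>mat_algebra n A\<^esub> Y) v
    = (\<Sum>k<n. cinner (\<Sum>i<n. Y (k, i) (v i)) (\<Sum>i<n. Y (k, i) (v i)))"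
proof -
  have "mat_form n (star (mat_algebra n A) Y \<otimes>\<^bsub>mat_algebra n A\<^esub> Y) v
      = (\<Sum>i<n. \<Sum>j<n. \<Sum>k<n. cinner (Y (k, i) (v i)) (Y (k, j) (v j)))"
    unfolding mat_form_def using assms by (intro sum.cong refl star_mult_entry) auto
  also have "\<dots> = (\<Sum>i<n. \<Sum>k<n. \<Sum>j<n. cinner (Y (k, i) (v i)) (Y (k, j) (v j)))"
    by (intro sum.cong refl sum.swap)
  also have "\<dots> = (\<Sum>k<n. \<Sum>i<n. \<Sum>j<n. cinner (Y (k, i) (v i)) (Y (k, j) (v j)))"
    by (rule sum.swap)
  finally show ?thesis
    unfolding cinner_sum_left unfolding cinner_sum_right .
qed

lemma positives_mat_form:
  assumes "X \<in> positives (mat_algebra n A)"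
  shows "X \<in> carrier (mat_algebra n A)" "(\<And>i. i < n \<Longrightarrow> v i \<in> M) \<Longrightarrow> mat_form n X v \<in> \<real>\<^sub>\<ge>\<^sub>0"
proof -
  obtain Y where Y: "Y \<in> carrier (mat_algebra n A)"
      "X = star (mat_algebra n A) Y \<otimes>\<^bsub>mat_algebra n A\<^esub> Y"
    using assms by (auto simp: positives_def)
  have "X \<in> extensional ({..<n} \<times> {..<n})"
    unfolding Y(2) by (simp add: mat_algebra_def)
  then show "X \<in> carrier (mat_algebra n A)"
    using star_mult_entry(1)[OF Y(1)] by (auto simp: mat_algebra_def PiE_iff Y(2))
  show "mat_form n X v \<in> \<real>\<^sub>\<ge>\<^sub>0" if "\<And>i. i < n \<Longrightarrow> v i \<in> M"
    unfolding Y(2) by (subst mat_form_star_mult[OF Y(1)])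
      (auto intro: that nonneg_Reals_sum cinner_self_nonneg)
qed

definition tuples :: "nat \<Rightarrow> (nat \<Rightarrow> 'h) set"
  where "tuples n = {f. (\<forall>i<n. f i \<in> M) \<and> (\<forall>i\<ge>n. f i = 0)}"

lemma unit_vec_tuples: "\<lbrakk>j < n; x \<in> M\<rbrakk> \<Longrightarrow> unit_vec j x \<in> tuples n"
  by (auto simp: tuples_def unit_vec_def M_0)

text \<open>Projecting the real basis to \<open>M\<close> gives a finite spanning set of \<open>M\<close> without choosing a basis of it.\<close>
lemma tuples_span: "tuples n = tuple_space.span ((\<lambda>(i, b). unit_vec i (proj M b)) ` ({..<n} \<times> Basis))"
  (is "_ = tuple_space.span ?B")
proof
  have B: "?B \<subseteq> tuples n"
    by (auto intro!: unit_vec_tuples proj_in[OF M])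
  show "tuple_space.span ?B \<subseteq> tuples n"
    by (rule tuple_space.span_minimal[OF B])
      (auto simp: tuple_space.subspace_def tuples_def M_0 M_add M_scaleC)
  show "tuples n \<subseteq> tuple_space.span ?B"
  proof
    fix f assume f: "f \<in> tuples n"
    have proj_sum: "proj M (\<Sum>b\<in>C. c b *\<^sub>C b) = (\<Sum>b\<in>C. c b *\<^sub>C proj M b)" for c and C :: "'h set"
      by (induction C rule: infinite_finite_induct)
        (auto simp: proj_add[OF M] proj_scaleC[OF M] proj_ident[OF M M_0])
    have "f i = (\<Sum>b\<in>Basis. complex_of_real (f i \<bullet> b) *\<^sub>C proj M b)" if "i < n" for i
    proof -
      have "f i = proj M (\<Sum>b\<in>Basis. complex_of_real (f i \<bullet> b) *\<^sub>C b)"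
        using f that by (simp add: euclidean_representation tuples_def proj_ident[OF M] scaleC_of_real)
      then show ?thesis
        by (simp only: proj_sum)
    qed
    then have "(\<Sum>b\<in>Basis. complex_of_real (f i \<bullet> b) *\<^sub>C unit_vec i (proj M b) k)
        = (if i = k then f k else 0)" if "i < n" for i k
      using that by (auto simp: unit_vec_def)
    then have "f = (\<Sum>i<n. \<Sum>b\<in>Basis. (\<lambda>k. complex_of_real (f i \<bullet> b) *\<^sub>C unit_vec i (proj M b) k))"
      using f by (auto simp: fun_eq_iff sum_fun_apply tuples_def)
    also have "\<dots> \<in> tuple_space.span ?B"
      by (intro tuple_space.span_sum tuple_space.span_scale tuple_space.span_base) auto
    finally show "f \<in> tuple_space.span ?B" .
  qed
qed

text \<open>
  The matrix \<open>X\<close> acts as a positive operator \<open>T\<close> on tuples of vectors of \<open>M\<close>. Its square root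
  \<open>S\<close> is a polynomial in \<open>T\<close>. An operator \<open>R \<in> \<R>\<close>, acting on each component, commutes with \<open>T\<close>
  and therefore with \<open>S\<close>, which says that the entries of the matrix \<open>Z\<close> of \<open>S\<close> lie in the algebra.
\<close>
lemma positives_if_mat_form:
  assumes X: "X \<in> carrier (mat_algebra n A)"
    and nonneg: "\<And>v. (\<And>i. i < n \<Longrightarrow> v i \<in> M) \<Longrightarrow> mat_form n X v \<in> \<real>\<^sub>\<ge>\<^sub>0"
  shows "X \<in> positives (mat_algebra n A)"
proof -
  (* Projecting to M first makes T linear on all functions, not only on tuples of M. *)
  define T where "T = (\<lambda>f i. if i < n then \<Sum>j<n. X (i, j) (proj M (f j)) else 0)"
  define ip where "ip = (\<lambda>f g. \<Sum>i<n. cinner (f i) (g i :: 'h))"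
  have X_entry: "X (i, j) \<in> carrier A" if "i < n" "j < n" for i j
    using mat_carrier_entry[OF X that] .
  have T_apply: "T f i = (\<Sum>j<n. X (i, j) (f j))" if "f \<in> tuples n" "i < n" for f i
    using that by (auto simp: T_def tuples_def proj_ident[OF M] intro!: sum.cong)
  interpret positive_operator "\<lambda>c f i. c *\<^sub>C (f i :: 'h)" ip "tuples n"
    "(\<lambda>(i, b). unit_vec i (proj M b)) ` ({..<n} \<times> Basis)" T
  proof
    fix f g :: "nat \<Rightarrow> 'h" and c
    show "T (f + g) = T f + T g"
      by (auto simp: T_def fun_eq_iff proj_add[OF M] carrier_add[OF X_entry] proj_in[OF M] sum.distrib)
    show "T (\<lambda>i. c *\<^sub>C f i) = (\<lambda>i. c *\<^sub>C T f i)"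
      by (auto simp: T_def fun_eq_iff proj_scaleC[OF M] carrier_scaleC[OF X_entry] proj_in[OF M]
          complex_vector.scale_sum_right)
    show "finite ((\<lambda>(i, b::'h). unit_vec i (proj M b)) ` ({..<n} \<times> Basis))"
      by simp
    show "ip f g = cnj (ip g f)"
      unfolding ip_def cnj_sum by (intro sum.cong refl cinner_commute)
  next
    fix f g h :: "nat \<Rightarrow> 'h" and c
    show "ip f (g + h) = ip f g + ip f h" "ip f (\<lambda>i. c *\<^sub>C g i) = c * ip f g"
      by (simp_all add: ip_def cinner_add_right sum.distrib cinner_scaleC_right sum_distrib_left)
  next
    fix f :: "nat \<Rightarrow> 'h" assume f: "f \<in> tuples n"
    show "T f \<in> tuples n"
      by (auto simp: tuples_def T_def intro!: complex_vector.subspace_sum[OF M]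
          carrier_in[OF X_entry] proj_in[OF M])
    show "ip f f \<in> \<real>\<^sub>\<ge>\<^sub>0"
      unfolding ip_def by (intro nonneg_Reals_sum cinner_self_nonneg)
    have "ip f (T f) = mat_form n X f"
      using f by (simp add: ip_def mat_form_def T_apply cinner_sum_right)
    then show "ip f (T f) \<in> \<real>\<^sub>\<ge>\<^sub>0"
      using nonneg[of f] f by (auto simp: tuples_def)
    assume "ip f f = 0"
    then have "complex_of_real (\<Sum>i<n. (norm (f i))\<^sup>2) = complex_of_real 0"
      by (simp only: ip_def cinner_self of_real_sum of_real_0)
    then have "(\<Sum>i<n. (norm (f i))\<^sup>2) = 0"
      by (simp only: of_real_eq_iff)
    then have "\<forall>i<n. f i = 0"
      by (subst (asm) sum_nonneg_eq_0_iff) auto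
    then have "f i = 0" for i
      using f by (cases "i < n") (auto simp: tuples_def)
    then show "f = 0"
      by (simp add: fun_eq_iff)
  qed (rule tuples_span)
  obtain q where q: "\<And>f. f \<in> tuples n \<Longrightarrow>
      poly_op (map_poly of_real q) (poly_op (map_poly of_real q) f) = T f"
    using square_root by blast
  define S where "S = poly_op (map_poly of_real q)"
  define Z where "Z = (\<lambda>(k, j)\<in>{..<n} \<times> {..<n}. \<lambda>x\<in>M. S (unit_vec j x) k)"
  have S_tuples: "S f \<in> tuples n" if "f \<in> tuples n" for f
    using that by (simp add: S_def poly_op_in_U)
  have Z_apply: "Z (k, j) x = S (unit_vec j x) k" if "k < n" "j < n" "x \<in> M" for k j x
    using that by (simp add: Z_def)
  have "Z (k, j) \<in> carrier A" if kj: "k < n" "j < n" for k j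
    unfolding carrier_iff operator_on_def
  proof (intro conjI ballI allI)
    show "Z (k, j) \<in> extensional M"
      using kj by (simp add: Z_def)
    show "Z (k, j) ` M \<subseteq> M"
      using kj S_tuples[OF unit_vec_tuples] by (auto simp: Z_apply tuples_def)
  next
    fix x y assume "x \<in> M" "y \<in> M"
    then show "Z (k, j) (x + y) = Z (k, j) x + Z (k, j) y"
      using kj by (simp add: Z_apply M_add unit_vec_add S_def poly_op_add_right)
  next
    fix c x assume "x \<in> M"
    then show "Z (k, j) (c *\<^sub>C x) = c *\<^sub>C Z (k, j) x"
      using kj by (simp add: Z_apply M_scaleC unit_vec_scaleC S_def poly_op_scale_right)
  next
    fix R x assume R: "R \<in> \<R>" and x: "x \<in> M"
    define R' where "R' = (\<lambda>f i. if i < n then R (f i) else (0::'h))"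
    have "R' (S (unit_vec j x)) = S (R' (unit_vec j x))"
      unfolding S_def
    proof (rule poly_op_commute)
      show "unit_vec j x \<in> tuples n"
        using kj x by (intro unit_vec_tuples)
    next
      fix f assume f: "f \<in> tuples n"
      show Rf: "R' f \<in> tuples n"
        using f R by (auto simp: R'_def tuples_def R_in)
      have "R (\<Sum>j<n. X (i, j) (f j)) = (\<Sum>j<n. X (i, j) (R (f j)))" if "i < n" for i
      proof -
        have "R (\<Sum>j<n. X (i, j) (f j)) = (\<Sum>j<n. R (X (i, j) (f j)))"
          using f that by (intro operator_on_sum[OF R_operator[OF R] M] carrier_in[OF X_entry])
            (auto simp: tuples_def)
        also have "\<dots> = (\<Sum>j<n. X (i, j) (R (f j)))"
          using f that R by (intro sum.cong refl carrier_commute[symmetric] X_entry)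
            (auto simp: tuples_def)
        finally show ?thesis .
      qed
      then show "R' (T f) = T (R' f)"
        using f Rf by (auto simp: fun_eq_iff R'_def T_apply) (auto simp: T_def)
      show "R' (\<lambda>i. c *\<^sub>C f i) = (\<lambda>i. c *\<^sub>C R' f i)" for c
        using f by (auto simp: fun_eq_iff R'_def tuples_def R_scaleC[OF R])
      show "R' (f + g) = R' f + R' g" if "g \<in> tuples n" for g
        using f that by (auto simp: fun_eq_iff R'_def tuples_def R_add[OF R])
    qed
    moreover have "R' (unit_vec j x) = unit_vec j (R x)"
      using kj R by (auto simp: fun_eq_iff R'_def unit_vec_def R_0)
    ultimately have "R' (S (unit_vec j x)) k = S (unit_vec j (R x)) k"
      by simp
    then show "Z (k, j) (R x) = R (Z (k, j) x)"
      using kj R x by (simp add: Z_apply R_in R'_def)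
  qed
  then have Z: "Z \<in> carrier (mat_algebra n A)"
    by (auto simp: mat_algebra_def PiE_iff Z_def)
  let ?ZZ = "star (mat_algebra n A) Z \<otimes>\<^bsub>mat_algebra n A\<^esub> Z"
  have "?ZZ (i, j) = X (i, j)" if ij: "i < n" "j < n" for i j
  proof (rule carrier_eqI)
    fix x assume x: "x \<in> M"
    show "?ZZ (i, j) x = X (i, j) x"
    proof (rule eq_if_cinner_eq[OF M])
      fix y assume y: "y \<in> M"
      have "cinner y (?ZZ (i, j) x) = (\<Sum>k<n. cinner (S (unit_vec i y) k) (S (unit_vec j x) k))"
        using ij x y by (simp add: star_mult_entry(2)[OF Z] Z_apply)
      also have "\<dots> = ip (S (unit_vec i y)) (S (unit_vec j x))"
        by (simp add: ip_def)
      also have "\<dots> = ip (unit_vec i y) (S (S (unit_vec j x)))"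
        unfolding S_def using ij x y by (intro poly_op_symmetric poly_op_in_U unit_vec_tuples)
      also have "\<dots> = ip (unit_vec i y) (T (unit_vec j x))"
        using ij x unfolding S_def by (simp only: q unit_vec_tuples)
      also have "\<dots> = (\<Sum>k<n. if k = i then cinner y (T (unit_vec j x) i) else 0)"
        unfolding ip_def by (intro sum.cong) (auto simp: unit_vec_def)
      also have "\<dots> = cinner y (T (unit_vec j x) i)"
        using ij by simp
      also have "T (unit_vec j x) i = (\<Sum>k<n. if k = j then X (i, j) x else 0)"
        unfolding T_apply[OF unit_vec_tuples[OF ij(2) x] ij(1)]
        using ij carrier_scaleC[OF X_entry M_0, of i _ 0]
        by (intro sum.cong) (auto simp: unit_vec_def)
      also have "\<dots> = X (i, j) x"
        using ij by simp
      finally show "cinner y (?ZZ (i, j) x) = cinner y (X (i, j) x)" .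
    qed (use carrier_in[OF star_mult_entry(1)[OF Z ij] x] carrier_in[OF X_entry[OF ij] x] in auto)
  qed (use ij X_entry star_mult_entry(1)[OF Z] in auto)
  moreover have "?ZZ \<in> extensional ({..<n} \<times> {..<n})"
    by (simp add: mat_algebra_def)
  ultimately have "?ZZ = X"
    using X by (intro extensionalityI[of _ "{..<n} \<times> {..<n}"]) (auto simp: mat_algebra_def PiE_iff)
  then show ?thesis
    using Z by (auto simp: positives_def)
qed

end

section \<open>Kraus operators\<close>

lemma complex_subspace_UNIV: "complex_vector.subspace UNIV"
  by (rule complex_vector.subspace_UNIV)

lemma UNIV_nonzero: "(UNIV :: 'h::{complex_inner, euclidean_space} set) \<noteq> {0}"
  using nonempty_Basis nonzero_Basis by blast

lemma operator_algebra_bop_UNIV: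
  "operator_algebra UNIV {} (bop (UNIV :: 'h::{complex_inner, euclidean_space} set))"
  by (rule operator_algebra_bop[OF complex_subspace_UNIV UNIV_nonzero])

lemma bounded_ops_UNIV_iff:
  fixes X :: "'h::{complex_inner, euclidean_space} \<Rightarrow> 'h"
  shows "X \<in> bounded_ops UNIV UNIV \<longleftrightarrow> operator_on UNIV UNIV X"
  by (simp add: bounded_ops_iff[OF complex_subspace_UNIV])

lemma carrier_bop [simp]: "carrier (bop L) = bounded_ops L L"
  by (simp add: bop_def)

text \<open>
  Choi's argument. The rank-one operators \<open>E i j\<close> of a tight frame \<open>e\<close> form a positive matrix, hence the matrix
  of the \<open>\<Phi> (E i j)\<close> is \<open>Z* Z\<close>. Expanding \<open>X\<close> in the \<open>E i j\<close> gives the Kraus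
  operators. The frame bound 2 is used three times: twice in the expansion of \<open>X\<close>, and once to insert the frame
  into the inner products of the \<open>Z (k, i) x\<close>. This makes the factor \<open>1 / 8\<close>, so each Kraus operator
  carries \<open>1 / sqrt 8\<close>.
\<close>
lemma kraus_representation:
  fixes \<Phi> :: "('h::{complex_inner, euclidean_space} \<Rightarrow> 'h) \<Rightarrow> ('h \<Rightarrow> 'h)"
  assumes cp: "completely_positive (bop UNIV) (bop UNIV) \<Phi>"
  obtains I :: "(nat \<times> nat) set" and V where "finite I" "\<And>k. k \<in> I \<Longrightarrow> operator_on UNIV UNIV (V k)"
    "\<And>X x y. operator_on UNIV UNIV X \<Longrightarrow> cinner x (\<Phi> X y) = (\<Sum>k\<in>I. cinner (V k x) (X (V k y)))"
proof -
  interpret operator_algebra UNIV "{}" "bop (UNIV :: 'h set)"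
    by (rule operator_algebra_bop_UNIV)
  define n where "n = card (Basis :: 'h set)"
  obtain e where e: "bij_betw e {..<n} (Basis :: 'h set)"
    using ex_bij_betw_nat_finite[OF finite_Basis] by (auto simp: n_def lessThan_atLeast0)
  have expansion: "(\<Sum>i<n. cinner (e i) x *\<^sub>C e i) = 2 *\<^sub>C x" for x
    unfolding frame_expansion[symmetric] by (rule sum.reindex_bij_betw[OF e])
  have Parseval: "(\<Sum>i<n. cinner x (e i) * cinner (e i) y) = 2 * cinner x y" for x y
    unfolding frame_Parseval[symmetric] by (rule sum.reindex_bij_betw[OF e])
  define E where "E = (\<lambda>i j x. cinner (e j) x *\<^sub>C e i)"
  have E: "E i j \<in> bounded_ops UNIV UNIV" for i j
    by (simp add: bounded_ops_UNIV_iff operator_on_def E_def cinner_add_right cinner_scaleC_right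
        complex_vector.scale_left_distrib)
  have lin: "linear_map (bop UNIV) (bop UNIV) \<Phi>"
    using cp by (simp add: completely_positive_def)
  have \<Phi>_add: "\<Phi> (\<lambda>x. S x + T x) x = \<Phi> S x + \<Phi> T x"
    if "operator_on UNIV UNIV S" "operator_on UNIV UNIV T" for S T x
    using lin that by (simp add: linear_map_def bop_def bounded_ops_UNIV_iff restrict_def)
  have \<Phi>_scale: "\<Phi> (\<lambda>x. c *\<^sub>C T x) x = c *\<^sub>C \<Phi> T x" if "operator_on UNIV UNIV T" for c T x
    using lin that by (simp add: linear_map_def bop_def bounded_ops_UNIV_iff restrict_def)
  have op_sum: "operator_on UNIV UNIV (\<lambda>x. \<Sum>k\<in>K. c k *\<^sub>C F k x)"
    if "\<And>k. k \<in> K \<Longrightarrow> operator_on UNIV UNIV (F k)"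
    for K :: "(nat \<times> nat) set" and c and F :: "nat \<times> nat \<Rightarrow> 'h \<Rightarrow> 'h"
    using that
    by (auto simp: operator_on_def sum.distrib complex_vector.scale_right_distrib
        complex_vector.scale_sum_right mult.commute)
  have \<Phi>_sum: "\<Phi> (\<lambda>x. \<Sum>k\<in>K. c k *\<^sub>C F k x) x = (\<Sum>k\<in>K. c k *\<^sub>C \<Phi> (F k) x)"
    if "finite K" "\<And>k. k \<in> K \<Longrightarrow> operator_on UNIV UNIV (F k)"
    for K :: "(nat \<times> nat) set" and c and F :: "nat \<times> nat \<Rightarrow> 'h \<Rightarrow> 'h" and x
    using that
  proof (induction K rule: finite_induct)
    case empty
    have "operator_on UNIV UNIV (\<lambda>x. 0 :: 'h)"
      by (simp add: operator_on_def)
    then show ?case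
      using \<Phi>_scale[of "\<lambda>x. 0" 0 x] by simp
  next
    case (insert k K)
    have "operator_on UNIV UNIV (\<lambda>x. c k *\<^sub>C F k x)"
      using op_sum[of "{k}" F c] insert.prems by simp
    then show ?case
      using insert by (simp add: \<Phi>_add op_sum \<Phi>_scale)
  qed
  let ?Mn = "mat_algebra n (bop (UNIV :: 'h set))"
  have "(\<lambda>(i, j)\<in>{..<n} \<times> {..<n}. E i j) \<in> positives ?Mn"
  proof (rule positives_if_mat_form)
    show "(\<lambda>(i, j)\<in>{..<n} \<times> {..<n}. E i j) \<in> carrier ?Mn"
      using E by (auto simp: mat_algebra_def)
    fix v :: "nat \<Rightarrow> 'h"
    have "mat_form n (\<lambda>(i, j)\<in>{..<n} \<times> {..<n}. E i j) v
        = (\<Sum>i<n. \<Sum>j<n. cnj (cinner (e i) (v i)) * cinner (e j) (v j))"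
      unfolding mat_form_def
      by (intro sum.cong refl)
        (simp add: E_def cinner_scaleC_right mult.commute cinner_commute[of "v _"])
    also have "\<dots> = cnj (\<Sum>i<n. cinner (e i) (v i)) * (\<Sum>i<n. cinner (e i) (v i))"
      by (simp add: sum_product)
    also have "\<dots> = complex_of_real ((cmod (\<Sum>i<n. cinner (e i) (v i)))\<^sup>2)"
      by (subst complex_norm_square) (rule mult.commute)
    finally show "mat_form n (\<lambda>(i, j)\<in>{..<n} \<times> {..<n}. E i j) v \<in> \<real>\<^sub>\<ge>\<^sub>0"
      by simp
  qed
  then have "(\<lambda>ij\<in>{..<n} \<times> {..<n}. \<Phi> ((\<lambda>(i, j)\<in>{..<n} \<times> {..<n}. E i j) ij)) \<in> positives ?Mn"
    using cp unfolding completely_positive_def by blast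
  then obtain Z where Z: "Z \<in> carrier ?Mn"
      "(\<lambda>ij\<in>{..<n} \<times> {..<n}. \<Phi> ((\<lambda>(i, j)\<in>{..<n} \<times> {..<n}. E i j) ij)) = star ?Mn Z \<otimes>\<^bsub>?Mn\<^esub> Z"
    unfolding positives_def by auto
  have Z_op: "operator_on UNIV UNIV (Z (k, j))" if "k < n" "j < n" for k j
    using carrier_operator[OF mat_carrier_entry[OF Z(1) that]] .
  have \<Phi>E: "cinner x (\<Phi> (E i j) y) = (\<Sum>k<n. cinner (Z (k, i) x) (Z (k, j) y))"
    if "i < n" "j < n" for i j x y
    using star_mult_entry(2)[OF Z(1) that, of x y] that fun_cong[OF Z(2), of "(i, j)"] by simp
  define V where "V = (\<lambda>(k, l) x. complex_of_real (1 / sqrt 8) *\<^sub>C (\<Sum>j<n. cinner (e l) (Z (k, j) x) *\<^sub>C e j))"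
  show ?thesis
  proof (rule that)
    show "finite ({..<n} \<times> {..<n})"
      by simp
  next
    fix kl assume "kl \<in> {..<n} \<times> {..<n}"
    then show "operator_on UNIV UNIV (V kl)"
      using Z_op
      by (auto simp: operator_on_def V_def cinner_add_right cinner_scaleC_right sum.distrib
          complex_vector.scale_right_distrib complex_vector.scale_left_distrib
          complex_vector.scale_sum_right add_divide_distrib ac_simps)
  next
    fix X :: "'h \<Rightarrow> 'h" and x y assume X: "operator_on UNIV UNIV X"
    have X_eq: "X = (\<lambda>x. \<Sum>(i, j)\<in>{..<n} \<times> {..<n}. (cinner (e i) (X (e j)) / 4) *\<^sub>C E i j x)"
    proof
      fix x
      have "4 *\<^sub>C X x = 2 *\<^sub>C X (2 *\<^sub>C x)"
        by (simp add: operator_on_scaleC[OF X])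
      also have "\<dots> = (\<Sum>i<n. cinner (e i) (X (2 *\<^sub>C x)) *\<^sub>C e i)"
        by (rule expansion[symmetric])
      also have "\<dots> = (\<Sum>i<n. \<Sum>j<n. (cinner (e j) x * cinner (e i) (X (e j))) *\<^sub>C e i)"
        by (simp add: expansion[of x, symmetric] operator_on_sum[OF X complex_subspace_UNIV]
            operator_on_scaleC[OF X] cinner_sum_right cinner_scaleC_right complex_vector.scale_sum_left)
      finally have "(1 / 4) *\<^sub>C 4 *\<^sub>C X x
          = (1 / 4) *\<^sub>C (\<Sum>i<n. \<Sum>j<n. (cinner (e j) x * cinner (e i) (X (e j))) *\<^sub>C e i)"
        by simp
      then show "X x = (\<Sum>(i, j)\<in>{..<n} \<times> {..<n}. (cinner (e i) (X (e j)) / 4) *\<^sub>C E i j x)"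
        by (simp add: E_def complex_vector.scale_sum_right sum.cartesian_product[symmetric] mult.commute)
    qed
    have "cinner x (\<Phi> X y) = (\<Sum>(i, j)\<in>{..<n} \<times> {..<n}.
        cinner (e i) (X (e j)) / 4 * cinner x (\<Phi> (E i j) y))"
    proof -
      have "\<Phi> X y = (\<Sum>ij\<in>{..<n} \<times> {..<n}.
          (cinner (e (fst ij)) (X (e (snd ij))) / 4) *\<^sub>C \<Phi> (E (fst ij) (snd ij)) y)"
        using \<Phi>_sum[of "{..<n} \<times> {..<n}" "\<lambda>ij. E (fst ij) (snd ij)"
            "\<lambda>ij. cinner (e (fst ij)) (X (e (snd ij))) / 4" y] E X_eq
        by (simp add: bounded_ops_UNIV_iff case_prod_beta)
      then show ?thesis
        by (simp add: cinner_sum_right cinner_scaleC_right case_prod_beta)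
    qed
    also have "\<dots> = (\<Sum>i<n. \<Sum>j<n. \<Sum>k<n. \<Sum>l<n.
        cinner (e i) (X (e j)) / 8 * (cinner (Z (k, i) x) (e l) * cinner (e l) (Z (k, j) y)))"
      unfolding sum.cartesian_product[symmetric] sum_distrib_left[symmetric] Parseval
      by (intro sum.cong refl) (simp add: \<Phi>E)
    also have "\<dots> = (\<Sum>k<n. \<Sum>l<n. \<Sum>i<n. \<Sum>j<n.
        cinner (e i) (X (e j)) / 8 * (cinner (Z (k, i) x) (e l) * cinner (e l) (Z (k, j) y)))"
      (is "(\<Sum>i<n. \<Sum>j<n. \<Sum>k<n. \<Sum>l<n. ?t i j k l) = _")
    proof -
      have "(\<Sum>i<n. \<Sum>j<n. \<Sum>k<n. \<Sum>l<n. ?t i j k l) = (\<Sum>i<n. \<Sum>k<n. \<Sum>j<n. \<Sum>l<n. ?t i j k l)"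
        by (intro sum.cong refl sum.swap)
      also have "\<dots> = (\<Sum>k<n. \<Sum>i<n. \<Sum>j<n. \<Sum>l<n. ?t i j k l)"
        by (rule sum.swap)
      also have "\<dots> = (\<Sum>k<n. \<Sum>i<n. \<Sum>l<n. \<Sum>j<n. ?t i j k l)"
        by (intro sum.cong refl sum.swap)
      also have "\<dots> = (\<Sum>k<n. \<Sum>l<n. \<Sum>i<n. \<Sum>j<n. ?t i j k l)"
        by (intro sum.cong refl sum.swap)
      finally show ?thesis .
    qed
    also have "\<dots> = (\<Sum>(k, l)\<in>{..<n} \<times> {..<n}. cinner (V (k, l) x) (X (V (k, l) y)))"
    proof -
      have "cinner (V (k, l) x) (X (V (k, l) y)) = (\<Sum>i<n. \<Sum>j<n.
          cinner (e i) (X (e j)) / 8 * (cinner (Z (k, i) x) (e l) * cinner (e l) (Z (k, j) y)))" for k l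
      proof -
        let ?s = "\<lambda>x. \<Sum>j<n. cinner (e l) (Z (k, j) x) *\<^sub>C e j"
        have "X (?s y) = (\<Sum>j<n. cinner (e l) (Z (k, j) y) *\<^sub>C X (e j))"
          by (simp add: operator_on_sum[OF X complex_subspace_UNIV] operator_on_scaleC[OF X])
        then have "cinner (?s x) (X (?s y)) = (\<Sum>i<n. \<Sum>j<n.
            cinner (cinner (e l) (Z (k, i) x) *\<^sub>C e i) (cinner (e l) (Z (k, j) y) *\<^sub>C X (e j)))"
          by (simp only: cinner_sum_left) (simp only: cinner_sum_right)
        also have "\<dots> = (\<Sum>i<n. \<Sum>j<n.
            cinner (e i) (X (e j)) * (cinner (Z (k, i) x) (e l) * cinner (e l) (Z (k, j) y)))"
          by (intro sum.cong refl)
            (simp add: cinner_scaleC_left cinner_scaleC_right cinner_commute[of "Z _ _"])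
        finally have "cinner (?s x) (X (?s y)) = \<dots>" .
        moreover have "complex_of_real (1 / sqrt 8) * complex_of_real (1 / sqrt 8) = 1 / 8"
          unfolding of_real_mult[symmetric] by simp
        ultimately have "cinner (V (k, l) x) (X (V (k, l) y)) = (1 / 8) * (\<Sum>i<n. \<Sum>j<n.
            cinner (e i) (X (e j)) * (cinner (Z (k, i) x) (e l) * cinner (e l) (Z (k, j) y)))"
          by (simp add: V_def operator_on_scaleC[OF X] cinner_scaleC_left cinner_scaleC_right
              mult.assoc[symmetric] del: of_real_divide)
        then show ?thesis
          by (simp add: sum_distrib_left)
      qed
      then show ?thesis
        by (simp only: sum.cartesian_product[symmetric] prod.case)
    qed
    finally show "cinner x (\<Phi> X y) = (\<Sum>kl\<in>{..<n} \<times> {..<n}. cinner (V kl x) (X (V kl y)))"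
      by (simp add: case_prod_beta)
  qed
qed

text \<open>
  Under a Kraus formula, the quadratic form of the image of a matrix is a sum of values of the quadratic form of the
  matrix, at the tuples transformed by the \<open>V k\<close>.
\<close>
lemma ucp_if_kraus:
  assumes A: "operator_algebra M \<R> A" and B: "operator_algebra N \<S> B"
    and V: "\<And>k v. \<lbrakk>k \<in> I; v \<in> N\<rbrakk> \<Longrightarrow> V k v \<in> M"
    and isometry: "\<And>u v. \<lbrakk>u \<in> N; v \<in> N\<rbrakk> \<Longrightarrow> (\<Sum>k\<in>I. cinner (V k u) (V k v)) = cinner u v"
    and closed: "\<And>a. a \<in> carrier A \<Longrightarrow> f a \<in> carrier B"
    and kraus: "\<And>a u v. \<lbrakk>a \<in> carrier A; u \<in> N; v \<in> N\<rbrakk> \<Longrightarrow>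
      cinner u (f a v) = (\<Sum>k\<in>I. cinner (V k u) (a (V k v)))"
  shows "ucp A B f"
proof -
  interpret A: operator_algebra M \<R> A
    by (rule A)
  interpret B: operator_algebra N \<S> B
    by (rule B)
  have eqI: "f a = b" if "a \<in> carrier A" "b \<in> carrier B"
    "\<And>u v. \<lbrakk>u \<in> N; v \<in> N\<rbrakk> \<Longrightarrow> (\<Sum>k\<in>I. cinner (V k u) (a (V k v))) = cinner u (b v)" for a b
  proof (rule B.carrier_eqI)
    fix v assume v: "v \<in> N"
    show "f a v = b v"
      using that v B.carrier_in[OF closed v] B.carrier_in[OF that(2) v]
      by (intro eq_if_cinner_eq[OF B.M]) (auto simp: kraus)
  qed (use that closed in auto)
  have lin: "linear_map A B f"
    unfolding linear_map_def
  proof (intro conjI ballI allI)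
    show "f \<in> carrier A \<rightarrow> carrier B"
      using closed by auto
  next
    fix a b assume ab: "a \<in> carrier A" "b \<in> carrier A"
    then show "f (a \<oplus>\<^bsub>A\<^esub> b) = f a \<oplus>\<^bsub>B\<^esub> f b"
      by (intro eqI A.add_closed B.add_closed closed)
        (simp_all add: A.add_apply B.add_apply V closed kraus cinner_add_right sum.distrib)
  next
    fix c a assume a: "a \<in> carrier A"
    then show "f (cscale A c a) = cscale B c (f a)"
      by (intro eqI A.cscale_closed B.cscale_closed closed)
        (simp_all add: A.cscale_apply B.cscale_apply V kraus cinner_scaleC_right sum_distrib_left)
  qed
  have "(\<lambda>ij\<in>{..<n} \<times> {..<n}. f (X ij)) \<in> positives (mat_algebra n B)" (is "?fX \<in> _")
    if X: "X \<in> positives (mat_algebra n A)" for n X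
  proof (rule B.positives_if_mat_form)
    have entry: "X (i, j) \<in> carrier A" if "i < n" "j < n" for i j
      using A.mat_carrier_entry[OF A.positives_mat_form(1)[OF X] that] .
    then show "?fX \<in> carrier (mat_algebra n B)"
      using closed by (auto simp: mat_algebra_def)
    fix v assume v: "\<And>i. i < n \<Longrightarrow> v i \<in> N"
    have "mat_form n ?fX v = (\<Sum>i<n. \<Sum>j<n. \<Sum>k\<in>I. cinner (V k (v i)) (X (i, j) (V k (v j))))"
      unfolding mat_form_def by (intro sum.cong refl) (simp add: entry kraus v)
    also have "\<dots> = (\<Sum>i<n. \<Sum>k\<in>I. \<Sum>j<n. cinner (V k (v i)) (X (i, j) (V k (v j))))"
      by (intro sum.cong refl sum.swap)
    also have "\<dots> = (\<Sum>k\<in>I. mat_form n X (\<lambda>i. V k (v i)))"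
      unfolding mat_form_def by (rule sum.swap)
    also have "\<dots> \<in> \<real>\<^sub>\<ge>\<^sub>0"
      using V v by (intro nonneg_Reals_sum A.positives_mat_form(2)[OF X]) auto
    finally show "mat_form n ?fX v \<in> \<real>\<^sub>\<ge>\<^sub>0" .
  qed
  moreover have "f \<one>\<^bsub>A\<^esub> = \<one>\<^bsub>B\<^esub>"
    by (intro eqI A.one_closed B.one_closed) (simp add: A.one_apply B.one_apply V isometry)
  ultimately show ?thesis
    using lin by (auto simp: ucp_def completely_positive_def)
qed

section \<open>Idempotent maps\<close>

locale idempotent_kraus =
  fixes I :: "'k set" and V :: "'k \<Rightarrow> 'h \<Rightarrow> 'h::{complex_inner, euclidean_space}"
    and \<Phi> :: "('h \<Rightarrow> 'h) \<Rightarrow> ('h \<Rightarrow> 'h)"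
  assumes finite_I: "finite I"
    and V_operator: "k \<in> I \<Longrightarrow> operator_on UNIV UNIV (V k)"
    and \<Phi>_operator: "operator_on UNIV UNIV X \<Longrightarrow> operator_on UNIV UNIV (\<Phi> X)"
    and kraus: "operator_on UNIV UNIV X \<Longrightarrow> cinner x (\<Phi> X y) = (\<Sum>k\<in>I. cinner (V k x) (X (V k y)))"
    and isometry: "(\<Sum>k\<in>I. cinner (V k x) (V k y)) = cinner x y"
    and idempotent: "operator_on UNIV UNIV X \<Longrightarrow> \<Phi> (\<Phi> X) = \<Phi> X"
begin

text \<open>The orthogonal complement consists of the vectors whose rank-one operator is mapped to 0 by \<open>\<Phi>\<close>.\<close>
definition support :: "'h set"
  where "support = complex_vector.span (\<Union>k\<in>I. range (V k))"

definition fixed :: "('h \<Rightarrow> 'h) \<Rightarrow> bool"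
  where "fixed X \<longleftrightarrow> operator_on UNIV UNIV X \<and> \<Phi> X = X"

abbreviation adj :: "('h \<Rightarrow> 'h) \<Rightarrow> 'h \<Rightarrow> 'h"
  where "adj \<equiv> hadjoint UNIV UNIV"

lemma adj_operator: "operator_on UNIV UNIV X \<Longrightarrow> operator_on UNIV UNIV (adj X)"
  using hadjoint_in_bounded_ops[OF complex_subspace_UNIV complex_subspace_UNIV, of X]
  by (simp add: bounded_ops_UNIV_iff)

lemma cinner_adj: "operator_on UNIV UNIV X \<Longrightarrow> cinner (adj X x) y = cinner x (X y)"
  by (simp add: cinner_hadjoint_left[OF complex_subspace_UNIV complex_subspace_UNIV])

lemma cinner_adj_right: "operator_on UNIV UNIV X \<Longrightarrow> cinner x (adj X y) = cinner (X x) y"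
  by (simp add: cinner_hadjoint_right[OF complex_subspace_UNIV complex_subspace_UNIV])

lemma operator_eqI: "(\<And>x y. cinner x (X y) = cinner x (Y y)) \<Longrightarrow> X = (Y :: 'h \<Rightarrow> 'h)"
  using eq_if_cinner_eq[OF complex_subspace_UNIV] by (intro ext) blast

lemma support_subspace: "complex_vector.subspace support"
  by (simp add: support_def complex_vector.subspace_span)

lemma V_in_support: "k \<in> I \<Longrightarrow> V k x \<in> support"
  unfolding support_def by (rule complex_vector.span_base) auto

lemma support_nonzero: "support \<noteq> {0}"
proof
  assume "support = {0}"
  then have zero: "V k x = 0" if "k \<in> I" for k x
    using V_in_support[OF that] by blast
  have "cinner x x = 0" for x :: 'h
    using isometry[of x x] by (simp add: zero)
  then show False
    using UNIV_nonzero by auto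
qed

lemma fixed_\<Phi>: "operator_on UNIV UNIV X \<Longrightarrow> fixed (\<Phi> X)"
  by (simp add: fixed_def \<Phi>_operator idempotent)

lemma fixed_adj:
  assumes "fixed X"
  shows "fixed (adj X)"
proof -
  have X: "operator_on UNIV UNIV X" "\<Phi> X = X"
    using assms by (auto simp: fixed_def)
  have "cinner x (\<Phi> (adj X) y) = cinner x (adj X y)" for x y
  proof -
    have "cinner x (\<Phi> (adj X) y) = (\<Sum>k\<in>I. cinner (X (V k x)) (V k y))"
      by (simp add: kraus adj_operator cinner_adj_right X(1))
    also have "\<dots> = cnj (\<Sum>k\<in>I. cinner (V k y) (X (V k x)))"
      unfolding cnj_sum by (intro sum.cong refl cinner_commute)
    also have "\<dots> = cnj (cinner y (X x))"
      using kraus[OF X(1), of y x] X(2) by simp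
    finally show ?thesis
      by (simp add: cinner_adj_right X(1) flip: cinner_commute)
  qed
  then have "\<Phi> (adj X) = adj X"
    by (rule operator_eqI)
  then show ?thesis
    using adj_operator[OF X(1)] by (simp add: fixed_def)
qed

text \<open>
  Expanding the squares, both mixed terms and the last term equal \<open>\<langle>X v, X v\<rangle>\<close>: the former because
  \<open>X\<close> is fixed, the latter because \<open>\<Phi>\<close> is unital.
\<close>
lemma sum_commutator:
  assumes X: "fixed X"
  shows "(\<Sum>k\<in>I. cinner (X (V k v) - V k (X v)) (X (V k v) - V k (X v)))
    = cinner v (\<Phi> (\<lambda>x. adj X (X x)) v) - cinner v (adj X (X v))"
proof -
  have op: "operator_on UNIV UNIV X" and \<Phi>X: "\<Phi> X = X"
    using X by (auto simp: fixed_def)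
  have op': "operator_on UNIV UNIV (\<lambda>x. adj X (X x))"
    using op adj_operator[OF op] by (auto simp: operator_on_def)
  have "(\<Sum>k\<in>I. cinner (X (V k v)) (X (V k v))) = cinner v (\<Phi> (\<lambda>x. adj X (X x)) v)"
    by (simp add: kraus[OF op'] cinner_adj_right[OF op])
  moreover have cross: "(\<Sum>k\<in>I. cinner (V k (X v)) (X (V k v))) = cinner (X v) (X v)"
    using kraus[OF op, of "X v" v] \<Phi>X by simp
  moreover have "(\<Sum>k\<in>I. cinner (X (V k v)) (V k (X v))) = cnj (\<Sum>k\<in>I. cinner (V k (X v)) (X (V k v)))"
    unfolding cnj_sum by (intro sum.cong refl cinner_commute)
  then have "(\<Sum>k\<in>I. cinner (X (V k v)) (V k (X v))) = cinner (X v) (X v)"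
    unfolding cross by (simp flip: cinner_commute)
  ultimately show ?thesis
    by (simp add: cinner_diff_left cinner_diff_right sum_subtractf isometry cinner_adj_right[OF op])
qed

text \<open>
  For \<open>v = V m x\<close> the right-hand side of \<open>sum_commutator\<close>, summed over \<open>m\<close>, vanishes by
  idempotence, and a vanishing sum of squares has vanishing terms.
\<close>
lemma fixed_commutes:
  assumes X: "fixed X" and k: "k \<in> I" and v: "v \<in> support"
  shows "X (V k v) = V k (X v)"
proof -
  have op: "operator_on UNIV UNIV X"
    using X by (auto simp: fixed_def)
  have op': "operator_on UNIV UNIV (\<lambda>x. adj X (X x))"
    using op adj_operator[OF op] by (auto simp: operator_on_def)
  have range: "X (V k (V m x)) = V k (X (V m x))" if m: "m \<in> I" for m x
  proof -
    (* All terms of this double sum are squares, and by idempotence the sum is 0. *)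
    let ?d = "\<lambda>m k. norm (X (V k (V m x)) - V k (X (V m x)))"
    have "complex_of_real (\<Sum>m\<in>I. \<Sum>k\<in>I. (?d m k)\<^sup>2)
        = (\<Sum>m\<in>I. \<Sum>k\<in>I. cinner (X (V k (V m x)) - V k (X (V m x))) (X (V k (V m x)) - V k (X (V m x))))"
      by (simp add: cinner_self)
    also have "\<dots> = cinner x (\<Phi> (\<Phi> (\<lambda>x. adj X (X x))) x) - cinner x (\<Phi> (\<lambda>x. adj X (X x)) x)"
      by (simp add: sum_commutator[OF X] sum_subtractf kraus[OF op'] kraus[OF \<Phi>_operator[OF op']])
    also have "\<dots> = 0"
      by (simp add: idempotent op')
    finally have "(\<Sum>m\<in>I. \<Sum>k\<in>I. (?d m k)\<^sup>2) = 0"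
      by (simp only: of_real_eq_0_iff)
    then have "(\<Sum>k\<in>I. (?d m k)\<^sup>2) = 0"
      using m finite_I by (subst (asm) sum_nonneg_eq_0_iff) (auto intro: sum_nonneg)
    then have "(?d m k)\<^sup>2 = 0"
      using k finite_I by (subst (asm) sum_nonneg_eq_0_iff) auto
    then show ?thesis
      by simp
  qed
  have add: "V k (x + y) = V k x + V k y" "X (x + y) = X x + X y" for x y
    using operator_on_add[OF V_operator[OF k]] operator_on_add[OF op] by auto
  have scale: "V k (c *\<^sub>C x) = c *\<^sub>C V k x" "X (c *\<^sub>C x) = c *\<^sub>C X x" for c x
    using operator_on_scaleC[OF V_operator[OF k]] operator_on_scaleC[OF op] by auto
  have zero: "V k 0 = 0" "X 0 = 0"
    using scale[of 0 0] by auto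
  show ?thesis
    using v unfolding support_def
    by (induction rule: complex_vector.span_induct_alt) (auto simp: add scale zero range)
qed

text \<open>
  Let \<open>z\<close> be the component of \<open>V m x\<close> orthogonal to all \<open>V k (V l y)\<close>, and \<open>E\<close> the rank-one operator
  of \<open>z\<close>. The form of \<open>\<Phi> (\<Phi> E)\<close> at \<open>x\<close> vanishes by orthogonality, and it equals the form of \<open>\<Phi> E\<close>, which is
  the sum of the squares \<open>|\<langle>z, V k x\<rangle>|\<^sup>2\<close>. So \<open>z\<close> is orthogonal to \<open>V m x\<close> too, and vanishes.
\<close>
lemma support_iterated: "support = complex_vector.span (\<Union>k\<in>I. \<Union>m\<in>I. range (\<lambda>x. V k (V m x)))"
  (is "_ = ?N")
proof
  have N: "complex_vector.subspace ?N"
    by (rule complex_vector.subspace_span)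
  show "?N \<subseteq> support"
    by (rule complex_vector.span_minimal[OF _ support_subspace]) (auto simp: V_in_support)
  have "V m x \<in> ?N" if m: "m \<in> I" for m x
  proof -
    define z where "z = V m x - proj ?N (V m x)"
    define E where "E = (\<lambda>v. cinner z v *\<^sub>C z)"
    have op: "operator_on UNIV UNIV E"
      by (auto simp: operator_on_def E_def cinner_add_right cinner_scaleC_right
          complex_vector.scale_left_distrib)
    have z: "cinner z v = 0" if "v \<in> ?N" for v
      using cinner_proj_left[OF N that] by (simp add: z_def cinner_diff_left)
    have "complex_of_real (\<Sum>k\<in>I. (cmod (cinner z (V k x)))\<^sup>2) = (\<Sum>k\<in>I. cinner (V k x) (E (V k x)))"
      by (simp add: E_def cinner_scaleC_right cinner_commute[of "V _ _" z] flip: complex_norm_square)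
    also have "\<dots> = cinner x (\<Phi> (\<Phi> E) x)"
      by (simp add: idempotent op kraus)
    also have "\<dots> = (\<Sum>m\<in>I. \<Sum>k\<in>I. cinner (V k (V m x)) (E (V k (V m x))))"
      by (simp add: kraus[OF \<Phi>_operator[OF op]] kraus[OF op])
    also have "\<dots> = 0"
    proof -
      have "cinner z (V k (V m x)) = 0" if "k \<in> I" "m \<in> I" for k m
        by (rule z[OF complex_vector.span_base]) (use that in auto)
      then show ?thesis
        by (simp add: E_def)
    qed
    finally have "(\<Sum>k\<in>I. (cmod (cinner z (V k x)))\<^sup>2) = 0"
      by (simp only: of_real_eq_0_iff)
    then have "cinner z (V m x) = 0"
      using m finite_I by (subst (asm) sum_nonneg_eq_0_iff) auto
    moreover have "cinner z (proj ?N (V m x)) = 0"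
      by (rule z[OF proj_in[OF N]])
    ultimately have "cinner z z = 0"
      by (simp add: z_def cinner_diff_right)
    then have "V m x = proj ?N (V m x)"
      by (simp add: z_def)
    then show ?thesis
      using proj_in[OF N, of "V m x"] by simp
  qed
  then show "support \<subseteq> ?N"
    unfolding support_def by (intro complex_vector.span_minimal[OF _ N]) auto
qed

text \<open>By \<open>support_iterated\<close> it suffices to treat \<open>v = V k (V m x)\<close>, and there \<open>X v = V k (X (V m x))\<close>.\<close>
lemma fixed_in_support:
  assumes X: "fixed X" and v: "v \<in> support"
  shows "X v \<in> support"
proof -
  have op: "operator_on UNIV UNIV X"
    using X by (auto simp: fixed_def)
  have "X 0 = 0"
    using operator_on_scaleC[OF op, of 0 0] by simp
  show ?thesis
    using v unfolding support_iterated
  proof (induction rule: complex_vector.span_induct_alt)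
    case base
    then show ?case
      by (simp add: \<open>X 0 = 0\<close> complex_vector.span_zero)
  next
    case (step c w v)
    then obtain k m x where km: "k \<in> I" "m \<in> I" "w = V k (V m x)"
      by auto
    have "X w = V k (X (V m x))"
      using km by (simp add: fixed_commutes[OF X] V_in_support)
    then have "X w \<in> support"
      using km(1) by (simp add: V_in_support)
    then show ?case
      using step.IH unfolding support_iterated[symmetric]
      by (simp add: operator_on_add[OF op] operator_on_scaleC[OF op]
          complex_vector.subspace_add[OF support_subspace] complex_vector.subspace_scale[OF support_subspace])
  qed
qed

lemma fixed_block_diagonal:
  assumes X: "fixed X"
  shows "block_diagonal support X"
  unfolding block_diagonal_def
proof
  have op: "operator_on UNIV UNIV X"
    using X by (auto simp: fixed_def)
  show "X ` support \<subseteq> support"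
    using fixed_in_support[OF X] by auto
  show "X ` ortho_compl support \<subseteq> ortho_compl support"
    using fixed_in_support[OF fixed_adj[OF X]] by (auto simp: ortho_compl_def simp flip: cinner_adj[OF op])
qed

text \<open>
  On the support, \<open>\<lambda>v. proj support (adj (V k) v)\<close> is the adjoint of the restriction of \<open>V k\<close>. Including it
  makes the family self-adjoint, and hence its commutant closed under the star.
\<close>
definition generators :: "('h \<Rightarrow> 'h) set"
  where "generators = V ` I \<union> (\<lambda>k v. proj support (adj (V k) v)) ` I"

abbreviation "fixed_algebra \<equiv> commutant support generators"

lemma generators_operator: "R \<in> generators \<Longrightarrow> operator_on support support R"
  using V_operator adj_operator
  by (auto simp: generators_def operator_on_def V_in_support proj_add[OF support_subspace]
      proj_scaleC[OF support_subspace] proj_in[OF support_subspace])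

lemma generators_adjoint:
  assumes "R \<in> generators"
  shows "\<exists>R'\<in>generators. \<forall>u\<in>support. \<forall>v\<in>support. cinner (R u) v = cinner u (R' v)"
proof -
  consider k where "k \<in> I" "R = V k" | k where "k \<in> I" "R = (\<lambda>v. proj support (adj (V k) v))"
    using assms by (auto simp: generators_def)
  then show ?thesis
  proof cases
    case 1
    then show ?thesis
      by (intro bexI[of _ "\<lambda>v. proj support (adj (V k) v)"])
        (auto simp: generators_def cinner_proj_right[OF support_subspace] cinner_adj_right V_operator)
  next
    case 2
    then show ?thesis
      by (intro bexI[of _ "V k"])
        (auto simp: generators_def cinner_proj_left[OF support_subspace] cinner_adj V_operator)
  qed
qed

lemma operator_algebra_fixed: "operator_algebra support generators fixed_algebra"
  by (rule operator_algebra_commutant[OF support_subspace support_nonzero generators_operator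
        generators_adjoint])

lemma cstar_algebra_fixed: "cstar_algebra fixed_algebra"
  by (rule cstar_algebra_commutant[OF support_subspace support_nonzero generators_operator
        generators_adjoint])

lemma compression_fixed:
  assumes X: "fixed X"
  shows "compression support X \<in> carrier fixed_algebra"
proof -
  interpret operator_algebra support generators fixed_algebra
    by (rule operator_algebra_fixed)
  have op: "operator_on UNIV UNIV X"
    using X by (auto simp: fixed_def)
  have eq: "compression support X = restrict X support"
    by (auto simp: compression_apply[OF support_subspace] restrict_def proj_ident[OF support_subspace]
        fixed_in_support[OF X])
  have "X (R v) = R (X v)" if R: "R \<in> generators" and v: "v \<in> support" for R v
  proof -
    consider k where "k \<in> I" "R = V k" | k where "k \<in> I" "R = (\<lambda>v. proj support (adj (V k) v))"
      using R by (auto simp: generators_def)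
    then show ?thesis
    proof cases
      case 1
      then show ?thesis
        using fixed_commutes[OF X] v by simp
    next
      case 2
      show ?thesis
      proof (rule eq_if_cinner_eq[OF support_subspace])
        have Rv: "R w \<in> support" for w
          by (simp add: 2 proj_in[OF support_subspace])
        then show "R (X v) \<in> support" "X (R v) \<in> support"
          using fixed_in_support[OF X] by auto
        have R_inner: "cinner u (R w) = cinner (V k u) w" if "u \<in> support" for u w
          using that 2 by (simp add: cinner_proj_right[OF support_subspace] cinner_adj_right V_operator)
        fix u assume u: "u \<in> support"
        have "cinner u (X (R v)) = cinner (V k (adj X u)) v"
          using u by (simp add: cinner_adj[OF op, symmetric] R_inner fixed_in_support[OF fixed_adj[OF X]])
        also have "\<dots> = cinner (adj X (V k u)) v"
          using u by (simp add: fixed_commutes[OF fixed_adj[OF X] 2(1)])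
        also have "\<dots> = cinner u (R (X v))"
          using u by (simp add: cinner_adj[OF op] R_inner)
        finally show "cinner u (X (R v)) = cinner u (R (X v))" .
      qed
    qed
  qed
  moreover have "operator_on support support X"
    using op fixed_in_support[OF X] by (auto simp: operator_on_def)
  ultimately show ?thesis
    unfolding eq carrier_iff
    using operator_on_restrict[OF support_subspace] by (simp add: R_in)
qed

definition \<Delta> :: "('h \<Rightarrow> 'h) \<Rightarrow> ('h \<Rightarrow> 'h)"
  where "\<Delta> a = \<Phi> (\<lambda>x. a (proj support x))"

text \<open>
  \<open>\<Delta>\<close> makes sense for all operators on the support, not only for those in the algebra. Its
  values are fixed by \<open>\<Phi>\<close>, so their compressions lie in the algebra.
\<close>
definition \<Gamma> :: "('h \<Rightarrow> 'h) \<Rightarrow> ('h \<Rightarrow> 'h)"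
  where "\<Gamma> Y = compression support (\<Delta> Y)"

lemma extension_operator:
  "a \<in> bounded_ops support support \<Longrightarrow> operator_on UNIV UNIV (\<lambda>x. a (proj support x))"
  using operator_on_comp_proj[OF support_subspace, of support a]
  by (auto simp: bounded_ops_iff[OF support_subspace] operator_on_def)

lemma fixed_\<Delta>: "a \<in> bounded_ops support support \<Longrightarrow> fixed (\<Delta> a)"
  unfolding \<Delta>_def by (intro fixed_\<Phi> extension_operator)

lemma \<Delta>_kraus:
  "a \<in> bounded_ops support support \<Longrightarrow>
    cinner x (\<Delta> a y) = (\<Sum>k\<in>I. cinner (V k x) (a (V k y)))"
  unfolding \<Delta>_def
  by (simp add: kraus extension_operator proj_ident[OF support_subspace] V_in_support)

lemma \<Delta>_compression:
  assumes X: "operator_on UNIV UNIV X"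
  shows "\<Delta> (compression support X) = \<Phi> X"
proof (rule operator_eqI)
  have "compression support X \<in> bounded_ops support support"
    using X by (auto simp: compression_apply[OF support_subspace] bounded_ops_iff[OF support_subspace]
        operator_on_def proj_add[OF support_subspace] proj_scaleC[OF support_subspace]
        proj_in[OF support_subspace] complex_vector.subspace_add[OF support_subspace]
        complex_vector.subspace_scale[OF support_subspace])
  then show "cinner x (\<Delta> (compression support X) y) = cinner x (\<Phi> X y)" for x y
    by (simp add: \<Delta>_kraus kraus[OF X] compression_apply[OF support_subspace] V_in_support
        cinner_proj_right[OF support_subspace])
qed

lemma fixed_algebra_bounded: "a \<in> carrier fixed_algebra \<Longrightarrow> a \<in> bounded_ops support support"
  by (simp add: operator_algebra.carrier_eq[OF operator_algebra_fixed])

text \<open>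
  On the support \<open>a\<close> can be moved to the right of \<open>V k\<close>, and what remains is the sum of the
  \<open>V\<^sub>k* V\<^sub>k\<close>, which is 1.
\<close>
lemma compression_\<Delta>:
  assumes a: "a \<in> carrier fixed_algebra"
  shows "compression support (\<Delta> a) = a"
proof -
  interpret operator_algebra support generators fixed_algebra
    by (rule operator_algebra_fixed)
  show ?thesis
  proof (rule carrier_eqI[OF compression_fixed[OF fixed_\<Delta>[OF fixed_algebra_bounded[OF a]]] a])
    fix v assume v: "v \<in> support"
    show "compression support (\<Delta> a) v = a v"
    proof (rule eq_if_cinner_eq[OF support_subspace])
      fix u assume u: "u \<in> support"
      have "cinner u (\<Delta> a v) = (\<Sum>k\<in>I. cinner (V k u) (V k (a v)))"
        unfolding \<Delta>_kraus[OF fixed_algebra_bounded[OF a]]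
        using carrier_commute[OF a _ v] by (intro sum.cong) (auto simp: generators_def)
      also have "\<dots> = cinner u (a v)"
        by (rule isometry)
      finally show "cinner u (compression support (\<Delta> a) v) = cinner u (a v)"
        using u v by (simp add: compression_apply[OF support_subspace] cinner_proj_right[OF support_subspace])
    qed (use v in \<open>auto simp: compression_apply[OF support_subspace] proj_in[OF support_subspace]
        intro: carrier_in[OF a]\<close>)
  qed
qed

lemma ucp_\<Delta>: "ucp fixed_algebra (bop UNIV) \<Delta>"
  by (rule ucp_if_kraus[OF operator_algebra_fixed operator_algebra_bop_UNIV, of I V])
    (use fixed_\<Delta>[OF fixed_algebra_bounded] in
      \<open>auto simp: V_in_support isometry \<Delta>_kraus fixed_algebra_bounded bounded_ops_UNIV_iff fixed_def\<close>)

lemma ucp_\<Gamma>: "ucp (bop support) fixed_algebra \<Gamma>"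
  by (rule ucp_if_kraus[OF operator_algebra_bop[OF support_subspace support_nonzero]
        operator_algebra_fixed, of I V])
    (auto simp: \<Gamma>_def V_in_support isometry \<Delta>_kraus compression_apply[OF support_subspace]
      cinner_proj_right[OF support_subspace] intro!: compression_fixed[OF fixed_\<Delta>, unfolded compression_apply[OF support_subspace]])

lemma cstar_hom_compression_\<Delta>: "cstar_hom fixed_algebra (bop support) (compression support \<circ> \<Delta>)"
proof -
  interpret A: operator_algebra support generators fixed_algebra
    by (rule operator_algebra_fixed)
  interpret B: operator_algebra support "{}" "bop support"
    by (rule operator_algebra_bop[OF support_subspace support_nonzero])
  define w where "w = compression support \<circ> \<Delta>"
  have w: "w a = a" if "a \<in> carrier fixed_algebra" for a
    using that by (simp add: w_def compression_\<Delta>)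
  have sub: "a \<in> carrier (bop support)" if "a \<in> carrier fixed_algebra" for a
    using that by (simp add: fixed_algebra_bounded)
  have add: "a \<oplus>\<^bsub>fixed_algebra\<^esub> b = a \<oplus>\<^bsub>bop support\<^esub> b"
    if "a \<in> carrier fixed_algebra" "b \<in> carrier fixed_algebra" for a b
    using that by (simp only: A.add_eq B.add_eq sub)
  have mult: "a \<otimes>\<^bsub>fixed_algebra\<^esub> b = a \<otimes>\<^bsub>bop support\<^esub> b" for a b
    by (simp only: A.mult_eq B.mult_eq)
  have scale: "cscale fixed_algebra c a = cscale (bop support) c a" for c a
    by (simp only: A.cscale_eq B.cscale_eq)
  have one: "\<one>\<^bsub>fixed_algebra\<^esub> = \<one>\<^bsub>bop support\<^esub>"
    by (simp only: A.one_eq B.one_eq)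
  have "w \<in> ring_hom fixed_algebra (bop support)"
    by (rule ring_hom_memI) (simp_all add: w A.closed sub del: carrier_bop flip: add mult one)
  moreover have "linear_map fixed_algebra (bop support) w"
    unfolding linear_map_def
    by (simp add: w A.closed sub Pi_iff del: carrier_bop flip: add scale)
  moreover have "w (star fixed_algebra a) = star (bop support) (w a)" if "a \<in> carrier fixed_algebra" for a
    unfolding w[OF that] w[OF A.star_closed[OF that]] by (simp only: A.star_eq B.star_eq)
  ultimately show ?thesis
    unfolding cstar_hom_def w_def by blast
qed

end

theorem theorem1p2:
  fixes \<Phi> :: "('h::{complex_inner, euclidean_space} \<Rightarrow> 'h) \<Rightarrow> ('h \<Rightarrow> 'h)"
  assumes "ucp (bop UNIV) (bop UNIV) \<Phi>"
    and "\<forall>X\<in>carrier (bop UNIV). \<Phi> (\<Phi> X) = \<Phi> X"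
  shows "\<exists>(M :: 'h set) (A :: ('h \<Rightarrow> 'h) cstar)
            (\<Delta> :: ('h \<Rightarrow> 'h) \<Rightarrow> ('h \<Rightarrow> 'h)) (\<Gamma> :: ('h \<Rightarrow> 'h) \<Rightarrow> ('h \<Rightarrow> 'h)).
      complex_vector.subspace M \<and> M \<noteq> {0} \<and> cstar_algebra A \<and>
      ucp A (bop UNIV) \<Delta> \<and> ucp (bop M) A \<Gamma> \<and>
      (\<forall>a\<in>carrier A. \<Gamma> (compression M (\<Delta> a)) = a) \<and>
      (\<forall>X\<in>carrier (bop UNIV). \<Delta> (\<Gamma> (compression M X)) = \<Phi> X) \<and>
      cstar_hom A (bop M) (compression M \<circ> \<Delta>) \<and>
      (\<forall>a\<in>carrier A. block_diagonal M (\<Delta> a))"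
proof -
  have cp: "completely_positive (bop UNIV) (bop UNIV) \<Phi>" and one: "\<Phi> \<one>\<^bsub>bop UNIV\<^esub> = \<one>\<^bsub>bop UNIV\<^esub>"
    using assms(1) by (auto simp: ucp_def)
  obtain I :: "(nat \<times> nat) set" and V where kraus: "finite I" "\<And>k. k \<in> I \<Longrightarrow> operator_on UNIV UNIV (V k)"
    "\<And>X x y. operator_on UNIV UNIV X \<Longrightarrow> cinner x (\<Phi> X y) = (\<Sum>k\<in>I. cinner (V k x) (X (V k y)))"
    using kraus_representation[OF cp] by blast
  interpret idempotent_kraus I V \<Phi>
  proof
    show "operator_on UNIV UNIV (\<Phi> X)" if "operator_on UNIV UNIV X" for X
      using cp that by (auto simp: completely_positive_def linear_map_def bounded_ops_UNIV_iff Pi_iff)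
    have "operator_on UNIV UNIV (\<lambda>x::'h. x)"
      by (simp add: operator_on_def)
    moreover have "\<Phi> (\<lambda>x. x) = (\<lambda>x. x)"
      using one by (simp add: bop_def restrict_def)
    ultimately show "(\<Sum>k\<in>I. cinner (V k x) (V k y)) = cinner x y" for x y
      using kraus(3)[of "\<lambda>x. x" x y] by simp
    show "\<Phi> (\<Phi> X) = \<Phi> X" if "operator_on UNIV UNIV X" for X
      using assms(2) that by (simp add: bounded_ops_UNIV_iff)
  qed (use kraus in auto)
  have "\<Gamma> (compression support (\<Delta> a)) = a" if "a \<in> carrier fixed_algebra" for a
    using that by (simp add: compression_\<Delta> \<Gamma>_def)
  moreover have "\<Delta> (\<Gamma> (compression support X)) = \<Phi> X" if "X \<in> carrier (bop UNIV)" for X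
    using that by (simp add: \<Gamma>_def bounded_ops_UNIV_iff \<Delta>_compression \<Phi>_operator idempotent)
  moreover have "block_diagonal support (\<Delta> a)" if "a \<in> carrier fixed_algebra" for a
    using that by (intro fixed_block_diagonal fixed_\<Delta> fixed_algebra_bounded)
  ultimately show ?thesis
    using support_subspace support_nonzero cstar_algebra_fixed ucp_\<Delta> ucp_\<Gamma> cstar_hom_compression_\<Delta>
    by blast
qed

end
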